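(* Let $s(n)=O(\log n)$ be a space bound. The class of languages recognized by $s(n)$-space private alternating Turing machines that are allowed to make only a constant number of universal moves equals $\mathsf{NL}$; the same holds for $s(n)$-space blind alternating Turing machines allowed a constant number of universal moves.
   Context: A private alternating Turing machine (PATM) is an alternating Turing machine (existential and universal states) in which a portion of the memory is private to the universal states: it cannot be read while the machine is in an existential state. It models a two-player game of incomplete information. A blind alternating Turing machine (BATM) is the special case in which universal moves may change only that private portion, so the existential player sees none of the universal player's moves. A PATM/BATM accepts a string iff the existential player has a winning strategy in the corresponding game. The number of universal moves is the number of steps taken from universal states along a computation. *)

theory Defs
  imports Complex_Main "HOL-Library.Landau_Symbols"
begin

section \<open>Off-line multitape memory\<close>

text \<open>
  The input is written on a read-only tape between two end markers. The work tapes are infinite to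
  the right; tape symbols and control states are natural numbers, 0 being the blank. Every machine
  below has finitely many rules, hence uses finitely many symbols and states.
\<close>

datatype 'a isym = LeftEnd | RightEnd | Letter 'a

datatype move = MoveL | Stay | MoveR

type_synonym tape = "nat \<times> (nat \<Rightarrow> nat)"  \<comment> \<open>head position, contents\<close>
type_synonym mem = "nat \<times> nat \<times> tape list"  \<comment> \<open>control state, input head position, work tapes\<close>

type_synonym 'a trigger = "nat \<times> 'a isym \<times> nat list"  \<comment> \<open>state, scanned input and tape symbols\<close>
type_synonym action = "nat \<times> move \<times> (nat \<times> move) list"  \<comment> \<open>next state, input head move, write-and-move on each tape\<close>

fun shift :: "move \<Rightarrow> nat \<Rightarrow> nat" where
  "shift MoveL h = h - 1"
| "shift Stay h = h"
| "shift MoveR h = h + 1"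

definition input_at :: "'a list \<Rightarrow> nat \<Rightarrow> 'a isym" where
  "input_at w h =
     (if h = 0 then LeftEnd else if h \<le> length w then Letter (w ! (h - 1)) else RightEnd)"

definition blank_tape :: tape where
  "blank_tape = (0, \<lambda>_. 0)"

fun scan :: "tape \<Rightarrow> nat" where
  "scan (h, f) = f h"

fun write_move :: "nat \<times> move \<Rightarrow> tape \<Rightarrow> tape" where
  "write_move (x, m) (h, f) = (shift m h, f(h := x))"

fun observe :: "'a list \<Rightarrow> mem \<Rightarrow> 'a trigger" where
  "observe w (q, h, ts) = (q, input_at w h, map scan ts)"

fun update :: "'a list \<Rightarrow> action \<Rightarrow> mem \<Rightarrow> mem" where
  "update w (q', m, as) (q, h, ts) = (q', min (length w + 1) (shift m h), map2 write_move as ts)"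

text \<open>A work head at position \<open>h\<close> of a one-way infinite tape witnesses the use of \<open>h + 1\<close> cells.\<close>

definition tapes_within :: "nat \<Rightarrow> tape list \<Rightarrow> bool" where
  "tapes_within b ts \<longleftrightarrow> (\<forall>t\<in>set ts. fst t < b)"

definition log_bounds :: "(nat \<Rightarrow> nat) set" where
  "log_bounds = {s. (\<lambda>n. real (s n)) \<in> O(\<lambda>n. ln (real n))}"


section \<open>Nondeterministic machines and NL\<close>

record 'a ntm =
  ntm_tapes :: nat
  ntm_start :: nat
  ntm_accepting :: "nat set"
  ntm_rules :: "('a trigger \<times> action) set"

definition ntm_wf :: "'a ntm \<Rightarrow> bool" where
  "ntm_wf M \<longleftrightarrow> finite (ntm_rules M) \<and>
     (\<forall>(_, (_, _, as))\<in>ntm_rules M. length as = ntm_tapes M)"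

inductive ntm_reach :: "'a ntm \<Rightarrow> 'a list \<Rightarrow> mem \<Rightarrow> bool" for M w where
  ntm_init: "ntm_reach M w (ntm_start M, 0, replicate (ntm_tapes M) blank_tape)"
| ntm_step: "ntm_reach M w c \<Longrightarrow> (observe w c, a) \<in> ntm_rules M \<Longrightarrow> ntm_reach M w (update w a c)"

definition ntm_language :: "'a ntm \<Rightarrow> 'a list set" where
  "ntm_language M = {w. \<exists>q h ts. ntm_reach M w (q, h, ts) \<and> q \<in> ntm_accepting M}"

definition ntm_space :: "'a ntm \<Rightarrow> (nat \<Rightarrow> nat) \<Rightarrow> bool" where
  "ntm_space M s \<longleftrightarrow>
     (\<forall>w q h ts. ntm_reach M w (q, h, ts) \<longrightarrow> tapes_within (s (length w)) ts)"

definition NSPACE :: "(nat \<Rightarrow> nat) \<Rightarrow> 'a list set set" where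
  "NSPACE s = {ntm_language M | M. ntm_wf M \<and> ntm_space M s}"

definition NL :: "'a list set set" where
  "NL = (\<Union>s\<in>log_bounds. NSPACE s)"


section \<open>Private and blind alternating machines\<close>

text \<open>
  A configuration consists of a mode (whose turn it is, or the outcome), the public memory and the
  private memory. Both memories contain a part of the finite control and some work tapes; the input
  head is public. The (existential or universal) states of the machine in the usual sense are the
  triples of mode, public control state and private control state.
\<close>

datatype mode = Exist | Univ | Accept | Reject

type_synonym priv_mem = "nat \<times> tape list"
type_synonym priv_trigger = "nat \<times> nat list"
type_synonym priv_action = "nat \<times> (nat \<times> move) list"
type_synonym config = "mode \<times> mem \<times> priv_mem"

fun priv_observe :: "priv_mem \<Rightarrow> priv_trigger" where
  "priv_observe (r, ts) = (r, map scan ts)"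

fun priv_update :: "priv_action \<Rightarrow> priv_mem \<Rightarrow> priv_mem" where
  "priv_update (r', as) (r, ts) = (r', map2 write_move as ts)"

text \<open>
  Existential rules neither read nor change the private memory; this is enforced by their type.
\<close>

record 'a patm =
  pub_tapes :: nat
  priv_tapes :: nat
  start_mode :: mode
  start_pub :: nat
  start_priv :: nat
  ex_rules :: "('a trigger \<times> (mode \<times> action)) set"
  un_rules :: "(('a trigger \<times> priv_trigger) \<times> (mode \<times> action \<times> priv_action)) set"

definition patm_wf :: "'a patm \<Rightarrow> bool" where
  "patm_wf M \<longleftrightarrow> finite (ex_rules M) \<and> finite (un_rules M) \<and>
     (\<forall>(_, (_, (_, _, as)))\<in>ex_rules M. length as = pub_tapes M) \<and>
     (\<forall>(_, (_, (_, _, as), (_, bs)))\<in>un_rules M.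
        length as = pub_tapes M \<and> length bs = priv_tapes M)"

text \<open>
  In a blind machine a universal move leaves the public memory (public control state, input head
  position, public tapes) as it is; only the private memory and the mode may change.
\<close>

definition blind :: "'a patm \<Rightarrow> bool" where
  "blind M \<longleftrightarrow>
     (\<forall>(((q, _, xs), _), (_, (q', m, as), _))\<in>un_rules M.
        q' = q \<and> m = Stay \<and> as = map (\<lambda>x. (x, Stay)) xs)"

definition init_config :: "'a patm \<Rightarrow> config" where
  "init_config M =
     (start_mode M,
      (start_pub M, 0, replicate (pub_tapes M) blank_tape),
      (start_priv M, replicate (priv_tapes M) blank_tape))"

text \<open>
  \<open>patm_reach M w k c\<close>: some computation on \<open>w\<close> (both players moving arbitrarily) leads
  to \<open>c\<close> with exactly \<open>k\<close> universal moves.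
\<close>

inductive patm_reach :: "'a patm \<Rightarrow> 'a list \<Rightarrow> nat \<Rightarrow> config \<Rightarrow> bool" for M w where
  reach_init: "patm_reach M w 0 (init_config M)"
| reach_exist:
    "patm_reach M w k (Exist, c, d) \<Longrightarrow> (observe w c, (md, a)) \<in> ex_rules M \<Longrightarrow>
     patm_reach M w k (md, update w a c, d)"
| reach_univ:
    "patm_reach M w k (Univ, c, d) \<Longrightarrow>
     ((observe w c, priv_observe d), (md, a, b)) \<in> un_rules M \<Longrightarrow>
     patm_reach M w (Suc k) (md, update w a c, priv_update b d)"

definition patm_space :: "'a patm \<Rightarrow> (nat \<Rightarrow> nat) \<Rightarrow> bool" where
  "patm_space M s \<longleftrightarrow>
     (\<forall>w k md q h ts r us. patm_reach M w k (md, (q, h, ts), (r, us)) \<longrightarrow>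
        tapes_within (s (length w)) ts \<and> tapes_within (s (length w)) us)"

definition const_universal_moves :: "'a patm \<Rightarrow> bool" where
  "const_universal_moves M \<longleftrightarrow> (\<exists>K. \<forall>w k c. patm_reach M w k c \<longrightarrow> k \<le> K)"

text \<open>
  A strategy of the existential player chooses a move from the sequence of public memory contents
  at the existential turns so far, the current one included. (Her own previous moves are determined
  by these.) \<open>wins M w \<sigma> hs c\<close>: with history \<open>hs\<close>, every play from \<open>c\<close> that follows
  \<open>\<sigma>\<close> ends after finitely many steps in mode \<open>Accept\<close> or with the universal
  player unable to move. The existential player loses if \<open>\<sigma>\<close> proposes a move which is not
  available, in particular if none is.
\<close>

type_synonym strategy = "mem list \<Rightarrow> mode \<times> action"

inductive wins :: "'a patm \<Rightarrow> 'a list \<Rightarrow> strategy \<Rightarrow> mem list \<Rightarrow> config \<Rightarrow> bool"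
  for M w \<sigma> where
  wins_accept: "wins M w \<sigma> hs (Accept, c, d)"
| wins_exist:
    "\<sigma> (hs @ [c]) = (md, a) \<Longrightarrow> (observe w c, (md, a)) \<in> ex_rules M \<Longrightarrow>
     wins M w \<sigma> (hs @ [c]) (md, update w a c, d) \<Longrightarrow>
     wins M w \<sigma> hs (Exist, c, d)"
| wins_univ:
    "(\<And>md a b. ((observe w c, priv_observe d), (md, a, b)) \<in> un_rules M \<Longrightarrow>
        wins M w \<sigma> hs (md, update w a c, priv_update b d)) \<Longrightarrow>
     wins M w \<sigma> hs (Univ, c, d)"

definition patm_language :: "'a patm \<Rightarrow> 'a list set" where
  "patm_language M = {w. \<exists>\<sigma>. wins M w \<sigma> [] (init_config M)}"

definition PATM_space_const_universal :: "(nat \<Rightarrow> nat) \<Rightarrow> 'a list set set" where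
  "PATM_space_const_universal s =
     {patm_language M | M. patm_wf M \<and> patm_space M s \<and> const_universal_moves M}"

definition BATM_space_const_universal :: "(nat \<Rightarrow> nat) \<Rightarrow> 'a list set set" where
  "BATM_space_const_universal s =
     {patm_language M | M. patm_wf M \<and> blind M \<and> patm_space M s \<and> const_universal_moves M}"

end

theory Submission
  imports Defs "HOL-Real_Asymp.Real_Asymp"
begin

text \<open>
  With at most \<open>K\<close> universal moves there are only finitely many ways, independent of the input, in
  which the universal player can choose her moves: the lists of at most \<open>K\<close> universal rules.
  Against a fixed strategy each list determines one play, and the strategy wins iff all these plays
  are won. A nondeterministic machine therefore runs all plays in lockstep and guesses the
  existential moves, subject to the condition that plays with equal histories receive equal moves.
  Equality of histories is a relation between finitely many plays, kept in the finite control.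
  To update it one must compare public memories that were equal before at most \<open>K\<close> universal moves
  on either side; such moves change only cells that they have scanned, so that a log of the
  observations and actions decides the comparison. The plays need one input head each; these heads
  are simulated by a single one with counters of logarithmic length. Conversely, a nondeterministic
  machine is an alternating one without universal moves.
\<close>

section \<open>Function-indexed tapes with left-end detection\<close>

text \<open>A history may be as long as the play, so it cannot be stored. A finite relation can
  replace it because histories only grow: two plays once told apart stay apart, so pairs are only
  ever removed, and the test for removal looks back no further than the last existential move. Plays
  not yet told apart had equal public memories at that turn and received equal moves, so they agree
  right after it and can differ later only through universal moves. The test makes sense only if the
  plays have their existential turns together; therefore all pending universal moves, which leave no
  trace in a history, are made first, and all histories have the same length at any time.

  Running all plays at once costs no work space beyond the given bound: their number is constant and
  space is measured on each tape separately. Only the counters for the input heads need more. Since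
  every reachable configuration has to respect the bound, also on failing guesses, each play is kept
  on a computation of the given machine.\<close>

instance isym :: (finite) finite
proof
  have "(UNIV :: 'a isym set) = {LeftEnd, RightEnd} \<union> range Letter"
    by (auto intro: isym.exhaust)
  then show "finite (UNIV :: 'a isym set)"
    by (metis finite.simps finite_UnI finite_imageI finite_UNIV)
qed

instance move :: finite
proof
  have "(UNIV :: move set) = {MoveL, Stay, MoveR}"
    by (auto intro: move.exhaust)
  then show "finite (UNIV :: move set)"
    by (metis finite.simps)
qed

instance mode :: finite
proof
  have "(UNIV :: mode set) = {Exist, Univ, Accept, Reject}"
    by (auto intro: mode.exhaust)
  then show "finite (UNIV :: mode set)"
    by (metis finite.simps)
qed

text \<open>
  Knowing whether a work head is at the left end costs nothing: a second tape whose only nonblank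
  cell is cell 0 moves in lockstep.
\<close>

definition look :: "tape \<Rightarrow> bool \<times> nat" where
  "look t = (fst t = 0, scan t)"

lemma look_pair: "look (h, f) = (h = 0, f h)"
  by (simp add: look_def)

lemma write_move_pair: "write_move e (h, f) = (shift (snd e) h, f(h := fst e))"
  by (cases e) simp

type_synonym 'i obs = "'i \<Rightarrow> bool \<times> nat"
type_synonym 'i acts = "'i \<Rightarrow> nat \<times> move"
type_synonym 'i tapes = "'i \<Rightarrow> tape"

definition write_all :: "'i acts \<Rightarrow> 'i tapes \<Rightarrow> 'i tapes" where
  "write_all a T = (\<lambda>i. write_move (a i) (T i))"

definition machine_step ::
  "('z \<Rightarrow> 'a isym \<Rightarrow> 'i obs \<Rightarrow> 'z \<times> move \<times> 'i acts \<Rightarrow> bool) \<Rightarrow> 'a list \<Rightarrow>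
   'z \<times> nat \<times> 'i tapes \<Rightarrow> 'z \<times> nat \<times> 'i tapes \<Rightarrow> bool" where
  "machine_step \<delta> w x y \<longleftrightarrow> (\<exists>z h T z' m a. x = (z, h, T) \<and> \<delta> z (input_at w h) (look \<circ> T) (z', m, a) \<and>
     y = (z', min (length w + 1) (shift m h), write_all a T))"

text \<open>Outside \<open>I\<close> everything is pinned to a blank tape that never moves. Hence
  there are finitely many observations and actions even if the index type is infinite.\<close>

definition obs_on :: "'i set \<Rightarrow> nat set \<Rightarrow> 'i obs set" where
  "obs_on I A = {ob. \<forall>i. (i \<in> I \<longrightarrow> ob i \<in> UNIV \<times> A) \<and> (i \<notin> I \<longrightarrow> ob i = (True, 0))}"

definition acts_on :: "'i set \<Rightarrow> nat set \<Rightarrow> 'i acts set" where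
  "acts_on I A = {a. \<forall>i. (i \<in> I \<longrightarrow> a i \<in> A \<times> UNIV) \<and> (i \<notin> I \<longrightarrow> a i = (0, Stay))}"

definition tapes_on :: "'i set \<Rightarrow> nat set \<Rightarrow> 'i tapes set" where
  "tapes_on I A = {T. \<forall>i. (i \<in> I \<longrightarrow> range (snd (T i)) \<subseteq> A) \<and> (i \<notin> I \<longrightarrow> T i = blank_tape)}"

lemma finite_obs_on: "finite I \<Longrightarrow> finite A \<Longrightarrow> finite (obs_on I A)"
  unfolding obs_on_def by (intro finite_set_of_finite_funs) auto

lemma finite_acts_on: "finite I \<Longrightarrow> finite A \<Longrightarrow> finite (acts_on I A)"
  unfolding acts_on_def by (intro finite_set_of_finite_funs) auto

lemma look_tapes_on: "T \<in> tapes_on I A \<Longrightarrow> look \<circ> T \<in> obs_on I A"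
proof -
  assume T: "T \<in> tapes_on I A"
  have "snd (look (T i)) \<in> A" if "i \<in> I" for i
  proof -
    have "range (snd (T i)) \<subseteq> A" using T that by (simp add: tapes_on_def)
    then show ?thesis by (cases "T i") (auto simp: look_pair)
  qed
  moreover have "look (T i) = (True, 0)" if "i \<notin> I" for i
    using T that by (auto simp: tapes_on_def look_def blank_tape_def)
  ultimately show ?thesis
    by (auto simp: obs_on_def mem_Times_iff)
qed

lemma write_all_tapes_on:
  assumes "T \<in> tapes_on I A" and "a \<in> acts_on I A"
  shows "write_all a T \<in> tapes_on I A"
proof -
  have "range (snd (write_move (a i) (T i))) \<subseteq> A" if "i \<in> I" for i
  proof -
    obtain h f where t: "T i = (h, f)" by fastforce
    have "range (snd (T i)) \<subseteq> A" "fst (a i) \<in> A"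
      using assms that by (simp_all add: tapes_on_def acts_on_def mem_Times_iff)
    then show ?thesis by (auto simp: t write_move_pair)
  qed
  moreover have "write_move (a i) (T i) = blank_tape" if "i \<notin> I" for i
    using assms that by (auto simp: tapes_on_def acts_on_def blank_tape_def)
  ultimately show ?thesis
    by (auto simp: tapes_on_def write_all_def)
qed

lemma blank_tapes_on: "0 \<in> A \<Longrightarrow> (\<lambda>_. blank_tape) \<in> tapes_on I A"
  by (auto simp: tapes_on_def blank_tape_def)

lemma in_NSPACE_I:
  assumes "ntm_wf M" "ntm_space M s" "ntm_language M = L"
  shows "L \<in> NSPACE s"
  using assms by (auto simp: NSPACE_def)

text \<open>This turns a transition relation over arbitrary states into a finite rule set. Each tape
  gets a marker tape beside it, and a first extra step, from a fresh state, writes the markers.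
  Finiteness comes from restricting the rules to \<open>Q\<close> and to observations over
  \<open>I\<close> and \<open>A\<close>, which \<open>closed\<close> shows to be no loss.\<close>

lemma machine_in_NSPACE:
  fixes \<delta> :: "'z \<Rightarrow> 'a::finite isym \<Rightarrow> 'i obs \<Rightarrow> 'z \<times> move \<times> 'i acts \<Rightarrow> bool"
  assumes fin: "finite Q" "finite A" "finite I" and z0: "z0 \<in> Q" and A0: "0 \<in> A"
    and closed: "\<And>z x ob z' m a. z \<in> Q \<Longrightarrow> ob \<in> obs_on I A \<Longrightarrow> \<delta> z x ob (z', m, a) \<Longrightarrow>
      z' \<in> Q \<and> a \<in> acts_on I A"
    and space: "\<And>w z h T i. (machine_step \<delta> w)\<^sup>*\<^sup>* (z0, 0, \<lambda>_. blank_tape) (z, h, T) \<Longrightarrow> i \<in> I \<Longrightarrow>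
      fst (T i) < s (length w)"
  shows "{w. \<exists>z h T. (machine_step \<delta> w)\<^sup>*\<^sup>* (z0, 0, \<lambda>_. blank_tape) (z, h, T) \<and> acc z} \<in> NSPACE s"
proof -
  obtain idx where idx: "set idx = I" "distinct idx"
    using finite_distinct_list[OF fin(3)] by blast
  obtain enc0 :: "'z \<Rightarrow> nat" where enc0: "inj_on enc0 Q"
    using finite_imp_inj_to_nat_seg[OF fin(1)] by blast
  \<comment> \<open>The code 0 stays free for the start state, in which the markers are
    written.\<close>
  define enc where "enc z = Suc (enc0 z)" for z
  have enc: "enc z = enc z' \<longleftrightarrow> z = z'" if "z \<in> Q" "z' \<in> Q" for z z'
    using enc0 that by (auto simp: enc_def inj_on_def)
  define mk :: "tape \<Rightarrow> tape" where "mk t = (fst t, (\<lambda>_. 0)(0 := 1))" for t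
  define obl :: "'i obs \<Rightarrow> nat list"
    where "obl ob = map (snd \<circ> ob) idx @ map (of_bool \<circ> fst \<circ> ob) idx" for ob
  define acl :: "'i obs \<Rightarrow> 'i acts \<Rightarrow> (nat \<times> move) list"
    where "acl ob a = map a idx @ map (\<lambda>i. (of_bool (fst (ob i)), snd (a i))) idx" for ob a
  define R0 :: "('a trigger \<times> action) set" where
    "R0 = (\<lambda>x. ((0, x, replicate (2 * length idx) 0),
      (enc z0, Stay, replicate (length idx) (0, Stay) @ replicate (length idx) (1, Stay)))) ` UNIV"
  define rl :: "'z \<times> 'a isym \<times> 'i obs \<times> 'z \<times> move \<times> 'i acts \<Rightarrow> 'a trigger \<times> action" where
    "rl = (\<lambda>(z, x, ob, z', m, a). ((enc z, x, obl ob), (enc z', m, acl ob a)))"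
  define D where "D = {(z, x, ob, z', m, a). z \<in> Q \<and> ob \<in> obs_on I A \<and> \<delta> z x ob (z', m, a)}"
  define N :: "'a ntm" where "N = \<lparr>ntm_tapes = 2 * length idx, ntm_start = 0,
     ntm_accepting = enc ` {z \<in> Q. acc z}, ntm_rules = R0 \<union> rl ` D\<rparr>"
  have "D \<subseteq> Q \<times> UNIV \<times> obs_on I A \<times> Q \<times> UNIV \<times> acts_on I A"
    using closed by (auto simp: D_def)
  then have "finite D"
    by (rule finite_subset) (intro finite_cartesian_product fin finite_obs_on finite_acts_on finite)
  then have wf: "ntm_wf N"
    by (auto simp: ntm_wf_def N_def R0_def rl_def acl_def)
  define rp :: "'z \<times> nat \<times> 'i tapes \<Rightarrow> mem" where
    "rp = (\<lambda>(z, h, T). (enc z, h, map T idx @ map (mk \<circ> T) idx))"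
  let ?init = "(z0, 0, \<lambda>_. blank_tape) :: 'z \<times> nat \<times> 'i tapes"
  let ?ninit = "(0, 0, replicate (2 * length idx) blank_tape) :: mem"
  have obs: "observe w (rp (z, h, T)) = (enc z, input_at w h, obl (look \<circ> T))" for w :: "'a list" and z h T
    by (auto simp: rp_def obl_def look_def mk_def)
  \<comment> \<open>A marker head rewrites what it scans and copies the move of its partner, so the
    pair stays aligned.\<close>
  have wm_mk: "write_move (of_bool (fst (look t)), m) (mk t) = mk (write_move (x, m) t)" for t m x
    by (cases t) (auto simp: mk_def look_pair)
  have upd: "update w (enc z', m, acl (look \<circ> T) a) (rp (z, h, T)) =
      rp (z', min (length w + 1) (shift m h), write_all a T)" for w :: "'a list" and z z' m a h T
    using wm_mk[of "T i" "snd (a i)" "fst (a i)" for i]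
    by (simp add: rp_def acl_def map2_map_map write_all_def comp_def)
  have upd0: "update w (enc z0, Stay, replicate (length idx) (0, Stay) @ replicate (length idx) (1, Stay)) ?ninit
      = rp ?init" for w :: "'a list"
  proof -
    have "replicate (2 * length idx) blank_tape = replicate (length idx) blank_tape @ replicate (length idx) blank_tape"
      by (simp add: mult_2 replicate_add)
    then show ?thesis
      by (simp add: rp_def zip_replicate blank_tape_def mk_def comp_def map_replicate_const fun_upd_def)
  qed
  have obs0: "observe w ?ninit = (0, LeftEnd, replicate (2 * length idx) 0)" for w :: "'a list"
    by (simp add: input_at_def blank_tape_def)
  have inv: "z \<in> Q \<and> T \<in> tapes_on I A"
    if "(machine_step \<delta> w)\<^sup>*\<^sup>* ?init (z, h, T)" for w z h T
    using that
  proof (induction "(z, h, T)" arbitrary: z h T rule: rtranclp_induct)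
    case base
    then show ?case using z0 blank_tapes_on[OF A0] by auto
  next
    case (step y)
    obtain z1 h1 T1 where y: "y = (z1, h1, T1)" using prod_cases3 by blast
    then have "z1 \<in> Q" "T1 \<in> tapes_on I A" using step by auto
    moreover obtain m a where "\<delta> z1 (input_at w h1) (look \<circ> T1) (z, m, a)" "T = write_all a T1"
      using step y by (auto simp: machine_step_def)
    ultimately show ?case
      using closed look_tapes_on write_all_tapes_on by metis
  qed
  have fwd: "ntm_reach N w (rp y)" if "(machine_step \<delta> w)\<^sup>*\<^sup>* ?init y" for w y
    using that
  proof (induction rule: rtranclp_induct)
    case base
    have "ntm_reach N w ?ninit"
      using ntm_init[of N w] by (simp add: N_def)
    moreover have "(observe w ?ninit, (enc z0, Stay, replicate (length idx) (0, Stay) @ replicate (length idx) (1, Stay)))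
        \<in> ntm_rules N"
      unfolding obs0 by (simp add: N_def R0_def)
    ultimately show ?case
      using ntm_step upd0 by metis
  next
    case (step y y')
    obtain z h T where y: "y = (z, h, T)" using prod_cases3 by blast
    have i: "z \<in> Q" "T \<in> tapes_on I A" using inv step(1) y by auto
    obtain z' m a where d: "\<delta> z (input_at w h) (look \<circ> T) (z', m, a)"
      and y': "y' = (z', min (length w + 1) (shift m h), write_all a T)"
      using step(2) y by (auto simp: machine_step_def)
    have "(z, input_at w h, look \<circ> T, z', m, a) \<in> D"
      using d i look_tapes_on by (auto simp: D_def)
    then have "rl (z, input_at w h, look \<circ> T, z', m, a) \<in> ntm_rules N"
      by (auto simp: N_def)
    then have "(observe w (rp y), (enc z', m, acl (look \<circ> T) a)) \<in> ntm_rules N"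
      unfolding y obs rl_def by simp
    from ntm_step[OF step(3) this] show ?case
      unfolding y upd y' .
  qed
  have bwd: "c = ?ninit \<or> (\<exists>y. (machine_step \<delta> w)\<^sup>*\<^sup>* ?init y \<and> c = rp y)" if "ntm_reach N w c" for w c
    using that
  proof induction
    case ntm_init
    then show ?case by (simp add: N_def)
  next
    case (ntm_step c act)
    from ntm_step.IH show ?case
    proof
      assume c: "c = ?ninit"
      have "act = (enc z0, Stay, replicate (length idx) (0, Stay) @ replicate (length idx) (1, Stay))"
        using ntm_step(2) unfolding c obs0 by (auto simp: N_def R0_def rl_def enc_def)
      then show ?thesis using c upd0 by blast
    next
      assume "\<exists>y. (machine_step \<delta> w)\<^sup>*\<^sup>* ?init y \<and> c = rp y"
      then obtain z h T where r: "(machine_step \<delta> w)\<^sup>*\<^sup>* ?init (z, h, T)" and c: "c = rp (z, h, T)" by auto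
      have i: "z \<in> Q" "T \<in> tapes_on I A" using inv r by auto
      have "(observe w c, act) \<in> rl ` D"
        using ntm_step(2) unfolding c obs by (auto simp: N_def R0_def enc_def)
      then obtain z1 x ob z' m a where D: "(z1, x, ob, z', m, a) \<in> D"
        and eq: "(enc z, input_at w h, obl (look \<circ> T)) = (enc z1, x, obl ob)" and act: "act = (enc z', m, acl ob a)"
        unfolding c obs by (auto simp: rl_def)
      have z1: "z1 = z" "x = input_at w h" using eq D enc i by (auto simp: D_def)
      \<comment> \<open>A rule trigger shows the observation on \<open>I\<close> only; outside
        \<open>I\<close> both sides have the default value, so the trigger determines all of
        it.\<close>
      have "ob i = look (T i)" for i
      proof (cases "i \<in> I")
        case True
        have "snd (ob i) = snd (look (T i))" "fst (ob i) = fst (look (T i))"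
          using eq True idx by (auto simp: obl_def of_bool_eq_iff split: if_splits)
        then show ?thesis by (simp add: prod_eq_iff)
      next
        case False
        then show ?thesis
          using D look_tapes_on[OF i(2)] by (auto simp: D_def obs_on_def)
      qed
      then have ob: "ob = look \<circ> T" by auto
      have "machine_step \<delta> w (z, h, T) (z', min (length w + 1) (shift m h), write_all a T)"
        using D z1 ob by (auto simp: machine_step_def D_def)
      then have "(machine_step \<delta> w)\<^sup>*\<^sup>* ?init (z', min (length w + 1) (shift m h), write_all a T)"
        using r by (rule rtranclp.rtrancl_into_rtrancl[rotated])
      moreover have "update w act c = rp (z', min (length w + 1) (shift m h), write_all a T)"
        unfolding act c ob upd ..
      ultimately show ?thesis by blast
    qed
  qed
  have sp: "ntm_space N s"
    unfolding ntm_space_def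
  proof (intro allI impI)
    fix w q h ts assume r: "ntm_reach N w (q, h, ts)"
    have "fst blank_tape < s (length w)" if "i \<in> I" for i
      using space[OF rtranclp.rtrancl_refl that, of w] by simp
    then have 1: "tapes_within (s (length w)) (replicate (2 * length idx) blank_tape)"
      using idx by (cases idx) (auto simp: tapes_within_def)
    have 2: "tapes_within (s (length w)) (snd (snd (rp y)))" if "(machine_step \<delta> w)\<^sup>*\<^sup>* ?init y" for y
      using that space idx by (cases y) (auto simp: tapes_within_def rp_def mk_def)
    show "tapes_within (s (length w)) ts"
      using bwd[OF r]
    proof
      assume "(q, h, ts) = ?ninit"
      then show ?thesis using 1 by simp
    next
      assume "\<exists>y. (machine_step \<delta> w)\<^sup>*\<^sup>* ?init y \<and> (q, h, ts) = rp y"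
      then show ?thesis using 2 by (metis snd_conv)
    qed
  qed
  have lang: "ntm_language N = {w. \<exists>z h T. (machine_step \<delta> w)\<^sup>*\<^sup>* ?init (z, h, T) \<and> acc z}"
  proof (intro set_eqI iffI)
    fix w assume "w \<in> ntm_language N"
    then obtain q h ts where r: "ntm_reach N w (q, h, ts)" and q: "q \<in> enc ` {z \<in> Q. acc z}"
      by (auto simp: ntm_language_def N_def)
    have "q \<noteq> 0" using q by (auto simp: enc_def)
    then obtain z h' T where "(machine_step \<delta> w)\<^sup>*\<^sup>* ?init (z, h', T)" "q = enc z"
      using bwd[OF r] by (auto simp: rp_def)
    then show "w \<in> {w. \<exists>z h T. (machine_step \<delta> w)\<^sup>*\<^sup>* ?init (z, h, T) \<and> acc z}"
      using q inv enc by blast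
  next
    fix w assume "w \<in> {w. \<exists>z h T. (machine_step \<delta> w)\<^sup>*\<^sup>* ?init (z, h, T) \<and> acc z}"
    then obtain z h T where r: "(machine_step \<delta> w)\<^sup>*\<^sup>* ?init (z, h, T)" "acc z" by blast
    show "w \<in> ntm_language N"
      using fwd[OF r(1)] inv[OF r(1)] r(2) unfolding rp_def
      by (auto simp: ntm_language_def N_def)
  qed
  show ?thesis
    using in_NSPACE_I[OF wf sp lang] .
qed

section \<open>A counter that is incremented and decremented in a single step\<close>

text \<open>
  A counter value is the number of steps made by an Euler tour of an infinite binary tree that has
  leaves but no root, starting at the leftmost leaf; blanks encode the left spine. The head at cell \<open>j\<close> is at a
  node of height \<open>j\<close>, and the cells from \<open>j\<close> on are the path upwards from that node
  (cells below \<open>j\<close> are junk). The control records whether the node is being left upwards, and the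
  symbol of the current cell when it has been determined only on arrival. Symbols below 2 mark left
  children, the others right children; even symbols mark nodes whose parent is on the left spine.
  Both directions of the tour are local, so no carry has to be propagated, and 0 is recognisable
  since the tour never goes down along the left spine after its start.
\<close>

type_synonym ctrl = "bool \<times> nat option"

definition eff :: "nat option \<Rightarrow> nat \<Rightarrow> nat" where
  "eff ov x = (case ov of None \<Rightarrow> x | Some y \<Rightarrow> y)"

definition ctick :: "ctrl \<Rightarrow> bool \<times> nat \<Rightarrow> ctrl \<times> nat \<times> move" where
  "ctick = (\<lambda>(up, ov) (fl, x). let b = eff ov x in
     if up then if b < 2 then ((False, None), b + 2, Stay) else ((True, None), b, MoveR)
     else if fl then ((True, None), b, Stay) else ((False, Some 1), b, MoveL))"

text \<open>A node reached upwards was entered from its right child, whose symbol may have been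
  overwritten in the copy on the tape or not been kept at all by later control. It need not be read:
  it is 2 or 3, and the parity convention makes it 2 exactly if the present node carries 0, that is,
  lies on the left spine.\<close>

definition cuntick :: "ctrl \<Rightarrow> bool \<times> nat \<Rightarrow> ctrl \<times> nat \<times> move" where
  "cuntick = (\<lambda>(up, ov) (fl, x). let b = eff ov x in
     if up then if fl then ((False, None), b, Stay)
       else ((True, Some (if b = 0 then 2 else 3)), b, MoveL)
     else if b \<ge> 2 then ((True, None), b - 2, Stay) else ((False, None), b, MoveR))"

definition czero :: "ctrl \<Rightarrow> bool \<times> nat \<Rightarrow> bool" where
  "czero = (\<lambda>(up, ov) (fl, x). \<not> up \<and> eff ov x = 0)"

text \<open>A finished left child is followed directly by its sibling; adding 2 keeps the parity
  since the parent is the same. On the way down the symbol of the new cell is set at once here,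
  whereas \<open>ctick\<close> puts it into the control, because a machine cannot write on the cell
  to which it is moving.\<close>

fun tick :: "bool \<times> nat \<times> (nat \<Rightarrow> nat) \<Rightarrow> bool \<times> nat \<times> (nat \<Rightarrow> nat)" where
  "tick (True, j, g) = (if g j < 2 then (False, j, g(j := g j + 2)) else (True, Suc j, g))"
| "tick (False, 0, g) = (True, 0, g)"
| "tick (False, Suc j, g) = (False, j, g(j := 1))"

definition tour :: "nat \<Rightarrow> bool \<times> nat \<times> (nat \<Rightarrow> nat)" where
  "tour n = (tick ^^ n) (False, 0, \<lambda>_. 0)"

lemma tour_0: "tour 0 = (False, 0, \<lambda>_. 0)"
  by (simp add: tour_def)

lemma tour_Suc: "tour (Suc n) = tick (tour n)"
  by (simp add: tour_def)

text \<open>The last conjunct rules out a descent along the left spine; this is why the symbol 1 set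
  by a descent has the right parity.\<close>

definition tour_inv :: "bool \<times> nat \<times> (nat \<Rightarrow> nat) \<Rightarrow> bool" where
  "tour_inv = (\<lambda>(up, j, g). (\<forall>i\<ge>j. g i \<le> 3 \<and> (even (g i) \<longleftrightarrow> g (Suc i) = 0)) \<and>
     (\<not> up \<longrightarrow> 0 < j \<longrightarrow> g j \<noteq> 0))"

lemma tour_inv: "tour_inv (tour n)"
proof (induction n)
  case 0
  then show ?case by (simp add: tour_0 tour_inv_def)
next
  case (Suc n)
  have "tour_inv (tick c)" if "tour_inv c" for c
    using that
  proof (cases c rule: tick.cases)
    case (1 j g)
    have "g j + 2 \<le> 3" if "g j < 2" using that by simp
    then show ?thesis using \<open>tour_inv c\<close> unfolding 1
      by (auto simp: tour_inv_def)
  next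
    case (2 g)
    then show ?thesis using \<open>tour_inv c\<close> by (auto simp: tour_inv_def)
  next
    case (3 j g)
    have "(g(j := 1)) i \<le> 3 \<and> (even ((g(j := 1)) i) \<longleftrightarrow> (g(j := 1)) (Suc i) = 0)" if "j \<le> i" for i
    proof (cases "i = j")
      case True
      then show ?thesis using 3 \<open>tour_inv c\<close> by (simp add: tour_inv_def)
    next
      case False
      then have "Suc j \<le> i" using that by simp
      then show ?thesis using 3 \<open>tour_inv c\<close> by (simp add: tour_inv_def)
    qed
    then show ?thesis unfolding 3 by (simp add: tour_inv_def)
  qed
  then show ?case using Suc by (simp add: tour_Suc)
qed

text \<open>
  The witness \<open>y\<close> is the index of the node among those of its height; the index of the leaf
  visited last grows by at most one per step, whence the logarithmic bound on the height.
\<close>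

definition leaf_inv :: "nat \<Rightarrow> bool \<times> nat \<times> (nat \<Rightarrow> nat) \<Rightarrow> bool" where
  "leaf_inv n = (\<lambda>(up, j, g). \<exists>y. (\<forall>i. odd (y div 2 ^ i) \<longleftrightarrow> 2 \<le> g (j + i)) \<and>
     (if up then Suc y * 2 ^ j \<le> Suc n else y * 2 ^ j \<le> n \<and> (0 < j \<longrightarrow> 0 < y)))"

lemma leaf_invI:
  assumes "\<And>i. odd (y div 2 ^ i) \<longleftrightarrow> 2 \<le> g (j + i)"
    and "if up then Suc y * 2 ^ j \<le> Suc n else y * 2 ^ j \<le> n \<and> (0 < j \<longrightarrow> 0 < y)"
  shows "leaf_inv n (up, j, g)"
  unfolding leaf_inv_def prod.case using assms by blast

text \<open>What is bounded by \<open>n\<close> is the first leaf below the node on the way down and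
  the last one on the way up. Only the step from a left child to its sibling increases it, by
  one.\<close>

lemma leaf_inv: "leaf_inv n (tour n)"
proof (induction n)
  case 0
  show ?case by (auto simp: tour_0 leaf_inv_def intro!: exI[of _ 0])
next
  case (Suc n)
  have "leaf_inv (Suc n) (tick c)" if "leaf_inv n c" for c
    using that
  proof (cases c rule: tick.cases)
    case (1 j g)
    then obtain y where bits: "\<And>i. odd (y div 2 ^ i) \<longleftrightarrow> 2 \<le> g (j + i)" and y: "Suc y * 2 ^ j \<le> Suc n"
      using \<open>leaf_inv n c\<close> unfolding leaf_inv_def by auto
    show ?thesis
    proof (cases "g j < 2")
      case True
      then have ev: "even y" using bits[of 0] by simp
      have "odd (Suc y div 2 ^ i) \<longleftrightarrow> 2 \<le> (g(j := g j + 2)) (j + i)" for i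
      proof (cases i)
        case 0
        then show ?thesis using ev by simp
      next
        case (Suc k)
        have 1: "Suc y div 2 ^ i = y div 2 ^ i"
          unfolding Suc power_Suc div_mult2_eq using ev by simp
        have 2: "(g(j := g j + 2)) (j + i) = g (j + i)"
          by (simp add: Suc)
        show ?thesis unfolding 1 2 by (rule bits)
      qed
      then have "leaf_inv (Suc n) (False, j, g(j := g j + 2))"
        by (rule leaf_invI) (use y in simp)
      then show ?thesis using True by (simp add: 1)
    next
      case False
      then have od: "odd y" using bits[of 0] by simp
      have "Suc (y div 2) * 2 ^ Suc j = Suc y * 2 ^ j"
        using od by (auto elim!: oddE)
      moreover have "odd (y div 2 div 2 ^ i) \<longleftrightarrow> 2 \<le> g (Suc j + i)" for i
        using bits[of "Suc i"] by (simp only: power_Suc div_mult2_eq add_Suc_right add_Suc)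
      then have "leaf_inv (Suc n) (True, Suc j, g)"
        by (rule leaf_invI) (use y calculation in simp)
      then show ?thesis using False by (simp add: 1)
    qed
  next
    case (2 g)
    then obtain y where bits: "\<And>i. odd (y div 2 ^ i) \<longleftrightarrow> 2 \<le> g (0 + i)" and y: "y \<le> n"
      using \<open>leaf_inv n c\<close> unfolding leaf_inv_def by auto
    have "leaf_inv (Suc n) (True, 0, g)"
      by (rule leaf_invI[OF bits]) (use y in simp)
    then show ?thesis by (simp add: 2)
  next
    case (3 j g)
    then obtain y where bits: "\<And>i. odd (y div 2 ^ i) \<longleftrightarrow> 2 \<le> g (Suc j + i)" and y: "y * 2 ^ Suc j \<le> n" "0 < y"
      using \<open>leaf_inv n c\<close> by (auto simp: leaf_inv_def)
    have "odd (2 * y div 2 ^ i) \<longleftrightarrow> 2 \<le> (g(j := 1)) (j + i)" for i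
    proof (cases i)
      case (Suc k)
      have 1: "2 * y div 2 ^ i = y div 2 ^ k"
        unfolding Suc power_Suc by simp
      have 2: "(g(j := 1)) (j + i) = g (Suc j + k)"
        by (simp add: Suc)
      show ?thesis unfolding 1 2 by (rule bits)
    qed simp
    then have "leaf_inv (Suc n) (False, j, g(j := 1))"
      by (rule leaf_invI) (use y in \<open>simp add: mult.assoc mult.left_commute\<close>)
    then show ?thesis by (simp add: 3)
  qed
  then show ?case using Suc by (simp add: tour_Suc)
qed

text \<open>On the way up all \<open>2 ^ j\<close> leaves below the node have been passed. On the
  way down at positive height the node is not the leftmost one, so at least \<open>2 ^ j\<close>
  leaves lie before it.\<close>

lemma tour_level: "tour n = (up, j, g) \<Longrightarrow> 2 ^ j \<le> Suc n"
proof -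
  assume "tour n = (up, j, g)"
  then obtain y :: nat where y: "if up then Suc y * 2 ^ j \<le> Suc n else y * 2 ^ j \<le> n \<and> (0 < j \<longrightarrow> 0 < y)"
    using leaf_inv[of n] by (auto simp: leaf_inv_def)
  show ?thesis
  proof (cases up)
    case True
    then show ?thesis using y by simp
  next
    case False
    show ?thesis
    proof (cases "j = 0")
      case False
      then have "1 * 2 ^ j \<le> y * 2 ^ j" using y \<open>\<not> up\<close> by (intro mult_le_mono1) auto
      also have "\<dots> \<le> Suc n" using y \<open>\<not> up\<close> by simp
      finally show ?thesis by simp
    qed simp
  qed
qed

definition holds :: "nat \<Rightarrow> ctrl \<Rightarrow> tape \<Rightarrow> bool" where
  "holds n = (\<lambda>(up, ov) (j, f). \<exists>g. tour n = (up, j, g) \<and> (\<forall>i>j. f i = g i) \<and> eff ov (f j) = g j)"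

lemma holds_blank: "holds 0 (False, None) blank_tape"
  by (simp add: holds_def tour_0 blank_tape_def eff_def)

lemma holds_level: "holds n s t \<Longrightarrow> 2 ^ fst t \<le> Suc n"
  using tour_level by (cases s; cases t) (auto simp: holds_def)

lemma holds_tick:
  assumes "holds n s t"
  shows "holds (Suc n) (fst (ctick s (look t))) (write_move (snd (ctick s (look t))) t)"
proof -
  obtain up ov j f where s: "s = (up, ov)" "t = (j, f)" by (cases s; cases t)
  then obtain g where g: "tour n = (up, j, g)" "\<forall>i>j. f i = g i" "eff ov (f j) = g j"
    using assms by (auto simp: holds_def)
  show ?thesis
  proof (cases "(up, j, g)" rule: tick.cases)
    case (3 k g')
    then show ?thesis using g s
      by (auto simp: ctick_def look_pair Let_def holds_def tour_Suc eff_def)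
  qed (use g s in \<open>auto simp: ctick_def look_pair Let_def holds_def tour_Suc eff_def\<close>)
qed

lemma holds_untick:
  assumes "holds (Suc n) s t"
  shows "holds n (fst (cuntick s (look t))) (write_move (snd (cuntick s (look t))) t)"
proof -
  obtain up ov j f where s: "s = (up, ov)" "t = (j, f)" by (cases s; cases t)
  then obtain g where g: "tour (Suc n) = (up, j, g)" "\<forall>i>j. f i = g i" "eff ov (f j) = g j"
    using assms by (auto simp: holds_def)
  obtain up' j' g' where n: "tour n = (up', j', g')" by (cases "tour n")
  have inv: "tour_inv (up', j', g')" using tour_inv[of n] n by simp
  have t: "tick (up', j', g') = (up, j, g)" using g(1) n by (simp add: tour_Suc)
  show ?thesis
  proof (cases "(up', j', g')" rule: tick.cases)
    case (1 j0 g0)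
    show ?thesis
    proof (cases "g' j' < 2")
      case True
      then have "up = False" "j = j'" "g = g'(j' := g' j' + 2)" using t 1 by auto
      then show ?thesis using g s n 1
        by (auto simp: cuntick_def look_pair Let_def holds_def eff_def)
    next
      case False
      then have u: "up = True" "j = Suc j'" "g = g'" using t 1 by auto
      have "g' j' \<le> 3" "even (g' j') \<longleftrightarrow> g' (Suc j') = 0"
        using inv by (auto simp: tour_inv_def)
      moreover have "g' j' = 2 \<or> g' j' = 3" using False \<open>g' j' \<le> 3\<close> by auto
      ultimately have "g' j' = (if g' (Suc j') = 0 then 2 else 3)" by auto
      then show ?thesis using g s n 1 u
        by (auto simp: cuntick_def look_pair Let_def holds_def eff_def less_Suc_eq Suc_lessI
              dest: Suc_lessI split: if_splits)
    qed
  next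
    case (2 g0)
    then show ?thesis using g s n t
      by (auto simp: cuntick_def look_pair Let_def holds_def eff_def)
  next
    case (3 j0 g0)
    then have u: "up = False" "j' = Suc j" "g = g'(j := 1)" using t by auto
    then show ?thesis using g s n 3
      by (auto simp: cuntick_def look_pair Let_def holds_def eff_def)
  qed
qed

text \<open>A step that ends in the downward direction has just raised a symbol by 2 or set it to 1,
  so it never shows 0.\<close>

lemma holds_zero:
  assumes "holds n s t"
  shows "czero s (look t) \<longleftrightarrow> n = 0"
proof -
  obtain up ov j f where s: "s = (up, ov)" "t = (j, f)" by (cases s; cases t)
  then obtain g where g: "tour n = (up, j, g)" "eff ov (f j) = g j"
    using assms by (auto simp: holds_def)
  have z: "czero s (look t) \<longleftrightarrow> \<not> up \<and> g j = 0"
    using g(2) by (simp add: s czero_def look_pair)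
  show ?thesis
  proof (cases n)
    case 0
    then show ?thesis using z g(1) by (auto simp: tour_0)
  next
    case (Suc m)
    obtain c where c: "c = tour m" by simp
    have "tick c = (up, j, g)" using g(1) Suc by (simp add: tour_Suc c)
    then have "up \<or> g j \<noteq> 0"
      by (cases c rule: tick.cases) (auto split: if_splits)
    then show ?thesis using z Suc by auto
  qed
qed

definition ctrls :: "ctrl set" where
  "ctrls = UNIV \<times> {None, Some 1, Some 2, Some 3}"

lemma finite_ctrls: "finite ctrls"
  by (simp add: ctrls_def)

lemma ctick_closed:
  assumes "s \<in> ctrls" "x \<le> b" "3 \<le> b" "ctick s (fl, x) = (s', y, m)"
  shows "s' \<in> ctrls" "y \<le> b"
  using assms by (auto simp: ctrls_def ctick_def Let_def eff_def split: if_splits)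

lemma cuntick_closed:
  assumes "s \<in> ctrls" "x \<le> b" "3 \<le> b" "cuntick s (fl, x) = (s', y, m)"
  shows "s' \<in> ctrls" "y \<le> b"
  using assms by (auto simp: ctrls_def cuntick_def Let_def eff_def split: if_splits)

section \<open>Several input heads\<close>

definition multihead_step ::
  "('z \<Rightarrow> (nat \<Rightarrow> 'a isym) \<Rightarrow> 'i obs \<Rightarrow> 'z \<times> (nat \<Rightarrow> move) \<times> 'i acts \<Rightarrow> bool) \<Rightarrow> 'a list \<Rightarrow>
   'z \<times> (nat \<Rightarrow> nat) \<times> 'i tapes \<Rightarrow> 'z \<times> (nat \<Rightarrow> nat) \<times> 'i tapes \<Rightarrow> bool" where
  "multihead_step \<delta> w x y \<longleftrightarrow> (\<exists>z p T z' m a. x = (z, p, T) \<and>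
     \<delta> z (\<lambda>j. input_at w (p j)) (look \<circ> T) (z', m, a) \<and>
     y = (z', \<lambda>j. min (length w + 1) (shift (m j) (p j)), write_all a T))"

definition idle :: "'i obs \<Rightarrow> 'i acts" where
  "idle ob = (\<lambda>i. (snd (ob i), Stay))"

lemma write_all_idle: "write_all (idle (look \<circ> T)) T = T"
proof
  fix i show "write_all (idle (look \<circ> T)) T i = T i"
    by (cases "T i") (simp add: write_all_def idle_def look_pair)
qed

lemma idle_on: "ob \<in> obs_on I A \<Longrightarrow> idle ob \<in> acts_on I A"
  by (auto simp: obs_on_def acts_on_def idle_def mem_Times_iff)

lemma write_all_upd: "write_all (a(i := e)) T = (write_all a T)(i := write_move e (T i))"
  by (auto simp: write_all_def)

text \<open>
  All heads but one are stored in counters. \<open>Load\<close> brings the real head from cell 0 to the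
  position of head \<open>i\<close> by counting down while moving right, and makes the pending move of that
  head; \<open>Store\<close> counts up again on the way back.
\<close>

datatype phase = Load | Read | Store

type_synonym ('z, 'a) head_state =
  "'z \<times> phase \<times> nat \<times> (nat \<Rightarrow> move) \<times> (nat \<Rightarrow> 'a isym) \<times> (nat \<Rightarrow> ctrl)"

fun head_sim :: "('z \<Rightarrow> (nat \<Rightarrow> 'a isym) \<Rightarrow> 'i obs \<Rightarrow> 'z \<times> (nat \<Rightarrow> move) \<times> 'i acts \<Rightarrow> bool) \<Rightarrow> nat \<Rightarrow>
    ('z, 'a) head_state \<Rightarrow> 'a isym \<Rightarrow> ('i + nat) obs \<Rightarrow> ('z, 'a) head_state \<times> move \<times> ('i + nat) acts \<Rightarrow> bool" where
  "head_sim \<delta> k (z, Load, i, m, xs, cs) x ob y \<longleftrightarrow>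
     (if czero (cs i) (ob (Inr i)) then y = ((z, Read, i, m, xs, cs), m i, idle ob)
      else case cuntick (cs i) (ob (Inr i)) of (c, e) \<Rightarrow>
        y = ((z, Load, i, m, xs, cs(i := c)), MoveR, (idle ob)(Inr i := e)))"
| "head_sim \<delta> k (z, Read, i, m, xs, cs) x ob y \<longleftrightarrow>
     y = ((z, Store, i, m, xs(i := x), cs), Stay, idle ob)"
| "head_sim \<delta> k (z, Store, i, m, xs, cs) x ob y \<longleftrightarrow>
     (if x \<noteq> LeftEnd then case ctick (cs i) (ob (Inr i)) of (c, e) \<Rightarrow>
        y = ((z, Store, i, m, xs, cs(i := c)), MoveL, (idle ob)(Inr i := e))
      else if Suc i < k then y = ((z, Load, Suc i, m, xs, cs), Stay, idle ob)
      else \<exists>z' m' a. \<delta> z xs (ob \<circ> Inl) (z', m', a) \<and>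
        y = ((z', Load, 0, m', xs, cs), Stay, case_sum a (idle ob \<circ> Inr)))"

lemma input_at_LeftEnd: "input_at w h = LeftEnd \<longleftrightarrow> h = 0"
  by (auto simp: input_at_def)

text \<open>
  The positions \<open>q\<close> are those before, and \<open>p\<close> those after the pending moves \<open>m\<close>.
\<close>

definition head_inv :: "'a list \<Rightarrow> nat \<Rightarrow> (nat \<Rightarrow> nat) \<Rightarrow> (nat \<Rightarrow> nat) \<Rightarrow>
    ('z, 'a) head_state \<times> nat \<times> ('i + nat) tapes \<Rightarrow> bool" where
  "head_inv w k q p = (\<lambda>((z, ph, i, m, xs, cs), h, T). i < k \<and>
     (\<forall>j<k. q j \<le> length w + 1 \<and> p j = min (length w + 1) (shift (m j) (q j))) \<and>
     (\<forall>j\<ge>k. p j = 0 \<and> xs j = LeftEnd) \<and>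
     (\<forall>j<i. xs j = input_at w (p j) \<and> holds (p j) (cs j) (T (Inr j))) \<and>
     (\<forall>j<k. i < j \<longrightarrow> holds (q j) (cs j) (T (Inr j))) \<and>
     (case ph of
        Load \<Rightarrow> \<exists>v. holds v (cs i) (T (Inr i)) \<and> h + v = q i
      | Read \<Rightarrow> holds 0 (cs i) (T (Inr i)) \<and> h = p i
      | Store \<Rightarrow> xs i = input_at w (p i) \<and> (\<exists>v. holds v (cs i) (T (Inr i)) \<and> h + v = p i)))"

text \<open>The phases of one head have values at most \<open>2 * n + 5\<close>, decreasing from
  \<open>Load\<close> over \<open>Read\<close> to \<open>Store\<close>; the factor
  \<open>2 * n + 6\<close> lets the change to the next head decrease the measure too.\<close>

fun head_measure :: "nat \<Rightarrow> nat \<Rightarrow> ('z, 'a) head_state \<times> nat \<times> ('i + nat) tapes \<Rightarrow> nat" where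
  "head_measure n k ((z, ph, i, m, xs, cs), h, T) = (k - i) * (2 * n + 6) +
     (case ph of Load \<Rightarrow> n + 4 + (n + 1 - h) | Read \<Rightarrow> n + 3 | Store \<Rightarrow> h)"

lemma machine_step_iff:
  "machine_step \<delta> w (z, h, T) y \<longleftrightarrow> (\<exists>r. \<delta> z (input_at w h) (look \<circ> T) r \<and>
     y = (fst r, min (length w + 1) (shift (fst (snd r)) h), write_all (snd (snd r)) T))"
  by (auto simp: machine_step_def)

text \<open>Between two uses of \<open>\<delta>\<close> the simulation is deterministic and
  terminating. Determinism gives soundness, since nothing else can happen; termination gives
  completeness, since the next use of \<open>\<delta>\<close> is reached.\<close>

lemma head_sim_progress:
  assumes inv: "head_inv w k q p ((z, ph, i, m, xs, cs), h, T)"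
    and nofire: "\<not> (ph = Store \<and> h = 0 \<and> \<not> Suc i < k)"
  obtains ph' i' xs' cs' h' T' where
    "\<And>y. machine_step (head_sim \<delta> k) w ((z, ph, i, m, xs, cs), h, T) y \<longleftrightarrow> y = ((z, ph', i', m, xs', cs'), h', T')"
    "head_inv w k q p ((z, ph', i', m, xs', cs'), h', T')"
    "T' \<circ> Inl = T \<circ> Inl"
    "head_measure (length w) k ((z, ph', i', m, xs', cs'), h', T') < head_measure (length w) k ((z, ph, i, m, xs, cs), h, T)"
proof (cases ph)
  case Load
  then obtain v where v: "holds v (cs i) (T (Inr i))" "h + v = q i" and q: "q i \<le> length w + 1"
      and p: "p i = min (length w + 1) (shift (m i) (q i))"
    using inv by (auto simp: head_inv_def)
  show ?thesis
  proof (cases "v = 0")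
    case True
    have z: "czero (cs i) ((look \<circ> T) (Inr i))" using holds_zero[OF v(1)] True by simp
    show ?thesis
    proof (rule that)
      show "machine_step (head_sim \<delta> k) w ((z, ph, i, m, xs, cs), h, T) y \<longleftrightarrow>
          y = ((z, Read, i, m, xs, cs), p i, T)" for y
        using z v True p unfolding Load machine_step_iff
        by (auto simp: write_all_idle)
      show "head_inv w k q p ((z, Read, i, m, xs, cs), p i, T)"
        using inv v True by (auto simp: head_inv_def)
    qed (use Load in auto)
  next
    case False
    then obtain v' where v': "v = Suc v'" by (cases v) auto
    have z: "\<not> czero (cs i) ((look \<circ> T) (Inr i))" using holds_zero[OF v(1)] False by simp
    obtain c e where ce: "cuntick (cs i) ((look \<circ> T) (Inr i)) = (c, e)" by (rule prod.exhaust)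
    have hv: "holds v' c (write_move e (T (Inr i)))"
      using holds_untick[of v'] v(1) ce v' by (metis comp_apply fst_conv snd_conv)
    show ?thesis
    proof (rule that)
      show "machine_step (head_sim \<delta> k) w ((z, ph, i, m, xs, cs), h, T) y \<longleftrightarrow>
          y = ((z, Load, i, m, xs, cs(i := c)), h + 1, T(Inr i := write_move e (T (Inr i))))" for y
        using z v v' q ce unfolding Load machine_step_iff
        by (auto simp: write_all_idle write_all_upd)
      show "head_inv w k q p ((z, Load, i, m, xs, cs(i := c)), h + 1, T(Inr i := write_move e (T (Inr i))))"
        using inv v v' hv by (auto simp: head_inv_def)
    qed (use Load v v' q in auto)
  qed
next
  case Read
  then have h: "holds 0 (cs i) (T (Inr i))" "h = p i" "p i \<le> length w + 1"
    using inv by (auto simp: head_inv_def)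
  show ?thesis
  proof (rule that)
    show "machine_step (head_sim \<delta> k) w ((z, ph, i, m, xs, cs), h, T) y \<longleftrightarrow>
        y = ((z, Store, i, m, xs(i := input_at w h), cs), h, T)" for y
      using h unfolding Read machine_step_iff
      by (auto simp: write_all_idle min_def)
    show "head_inv w k q p ((z, Store, i, m, xs(i := input_at w h), cs), h, T)"
      using inv h by (auto simp: head_inv_def)
  qed (use Read h in auto)
next
  case Store
  then obtain v where v: "holds v (cs i) (T (Inr i))" "h + v = p i" and p: "p i \<le> length w + 1"
    and xi: "xs i = input_at w (p i)" and ik: "i < k"
    using inv by (auto simp: head_inv_def)
  show ?thesis
  proof (cases "h = 0")
    case True
    then have k: "Suc i < k" using nofire Store by auto
    have l: "input_at w h = LeftEnd" using True by (simp add: input_at_LeftEnd)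
    show ?thesis
    proof (rule that)
      show "machine_step (head_sim \<delta> k) w ((z, ph, i, m, xs, cs), h, T) y \<longleftrightarrow>
          y = ((z, Load, Suc i, m, xs, cs), 0, T)" for y
        using l k True unfolding Store machine_step_iff
        by (auto simp: write_all_idle)
      show "head_inv w k q p ((z, Load, Suc i, m, xs, cs), 0, T)"
        using inv v k True xi by (auto simp: head_inv_def less_Suc_eq)
      have "k - i = Suc (k - Suc i)" using k by simp
      then show "head_measure (length w) k ((z, Load, Suc i, m, xs, cs), 0, T) <
          head_measure (length w) k ((z, ph, i, m, xs, cs), h, T)"
        using Store by simp
    qed simp
  next
    case False
    then have l: "input_at w h \<noteq> LeftEnd" by (simp add: input_at_LeftEnd)
    obtain c e where ce: "ctick (cs i) ((look \<circ> T) (Inr i)) = (c, e)" by (rule prod.exhaust)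
    have hv: "holds (Suc v) c (write_move e (T (Inr i)))"
      using holds_tick[OF v(1)] ce by (metis comp_apply fst_conv snd_conv)
    show ?thesis
    proof (rule that)
      show "machine_step (head_sim \<delta> k) w ((z, ph, i, m, xs, cs), h, T) y \<longleftrightarrow>
          y = ((z, Store, i, m, xs, cs(i := c)), h - 1, T(Inr i := write_move e (T (Inr i))))" for y
        using l ce v p unfolding Store machine_step_iff
        by (auto simp: write_all_idle write_all_upd)
      show "head_inv w k q p ((z, Store, i, m, xs, cs(i := c)), h - 1, T(Inr i := write_move e (T (Inr i))))"
        using inv v hv False Store by (auto simp: head_inv_def intro!: exI[of _ "Suc v"])
    qed (use Store False in auto)
  qed
qed

lemma head_sim_fire:
  assumes inv: "head_inv w k q p ((z, Store, i, m, xs, cs), 0, T)" and i: "\<not> Suc i < k"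
  shows "machine_step (head_sim \<delta> k) w ((z, Store, i, m, xs, cs), 0, T) y \<longleftrightarrow>
    (\<exists>z' m' a. \<delta> z (\<lambda>j. input_at w (p j)) (look \<circ> (T \<circ> Inl)) (z', m', a) \<and>
       y = ((z', Load, 0, m', xs, cs), 0, case_sum (write_all a (T \<circ> Inl)) (T \<circ> Inr)))"
    and "(\<forall>j\<ge>k. m' j = Stay) \<Longrightarrow> head_inv w k p (\<lambda>j. min (length w + 1) (shift (m' j) (p j)))
       ((z', Load, 0, m', xs, cs), 0, case_sum U (T \<circ> Inr))"
proof -
  \<comment> \<open>Heads from \<open>k\<close> on never leave cell 0, so the default
    \<open>LeftEnd\<close> is what they scan.\<close>
  have xs: "xs j = input_at w (p j)" for j
  proof (cases "j < k")
    case True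
    then have "j < i \<or> j = i" using i by auto
    then show ?thesis using inv by (auto simp: head_inv_def)
  next
    case False
    then show ?thesis using inv by (auto simp: head_inv_def input_at_def)
  qed
  have "write_all (case_sum a (idle (look \<circ> T) \<circ> Inr)) T = case_sum (write_all a (T \<circ> Inl)) (T \<circ> Inr)" for a
  proof
    fix t show "write_all (case_sum a (idle (look \<circ> T) \<circ> Inr)) T t =
        case_sum (write_all a (T \<circ> Inl)) (T \<circ> Inr) t"
      using fun_cong[OF write_all_idle[of T], of t]
      by (cases t) (auto simp: write_all_def)
  qed
  moreover have "xs = (\<lambda>j. input_at w (p j))" using xs by auto
  ultimately show "machine_step (head_sim \<delta> k) w ((z, Store, i, m, xs, cs), 0, T) y \<longleftrightarrow>
    (\<exists>z' m' a. \<delta> z (\<lambda>j. input_at w (p j)) (look \<circ> (T \<circ> Inl)) (z', m', a) \<and>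
       y = ((z', Load, 0, m', xs, cs), 0, case_sum (write_all a (T \<circ> Inl)) (T \<circ> Inr)))"
    using i unfolding machine_step_iff
    by (simp add: input_at_LeftEnd comp_assoc) (force simp: comp_assoc)
  assume m': "\<forall>j\<ge>k. m' j = Stay"
  have "holds (p j) (cs j) (T (Inr j))" if "j < k" for j
  proof -
    have "j < i \<or> j = i" using that i by auto
    then show ?thesis using inv by (auto simp: head_inv_def)
  qed
  then show "head_inv w k p (\<lambda>j. min (length w + 1) (shift (m' j) (p j)))
       ((z', Load, 0, m', xs, cs), 0, case_sum U (T \<circ> Inr))"
    using inv m' by (auto simp: head_inv_def)
qed

lemma head_sim_reach_fire:
  assumes "head_inv w k q p ((z, ph, i, m, xs, cs), h, T)"
  obtains i' xs' cs' T' where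
    "(machine_step (head_sim \<delta> k) w)\<^sup>*\<^sup>* ((z, ph, i, m, xs, cs), h, T) ((z, Store, i', m, xs', cs'), 0, T')"
    "head_inv w k q p ((z, Store, i', m, xs', cs'), 0, T')" "\<not> Suc i' < k" "T' \<circ> Inl = T \<circ> Inl"
  using assms
proof (induction "head_measure (length w) k ((z, ph, i, m, xs, cs), h, T)"
    arbitrary: ph i xs cs h T thesis rule: less_induct)
  case less
  show ?case
  proof (cases "ph = Store \<and> h = 0 \<and> \<not> Suc i < k")
    case True
    then show ?thesis using less.prems(2) by (intro less.prems(1)[of i xs cs T]) auto
  next
    case False
    obtain ph1 i1 xs1 cs1 h1 T1 where 1:
      "\<And>y. machine_step (head_sim \<delta> k) w ((z, ph, i, m, xs, cs), h, T) y \<longleftrightarrow> y = ((z, ph1, i1, m, xs1, cs1), h1, T1)"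
      "head_inv w k q p ((z, ph1, i1, m, xs1, cs1), h1, T1)"
      "T1 \<circ> Inl = T \<circ> Inl"
      "head_measure (length w) k ((z, ph1, i1, m, xs1, cs1), h1, T1) < head_measure (length w) k ((z, ph, i, m, xs, cs), h, T)"
      using head_sim_progress[OF less.prems(2) False, of \<delta>] by blast
    obtain i' xs' cs' T' where 2:
      "(machine_step (head_sim \<delta> k) w)\<^sup>*\<^sup>* ((z, ph1, i1, m, xs1, cs1), h1, T1) ((z, Store, i', m, xs', cs'), 0, T')"
      "head_inv w k q p ((z, Store, i', m, xs', cs'), 0, T')" "\<not> Suc i' < k" "T' \<circ> Inl = T1 \<circ> Inl"
      using less.hyps[OF 1(4) _ 1(2)] by blast
    have "machine_step (head_sim \<delta> k) w ((z, ph, i, m, xs, cs), h, T) ((z, ph1, i1, m, xs1, cs1), h1, T1)"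
      by (simp only: 1(1))
    from converse_rtranclp_into_rtranclp[of "machine_step (head_sim \<delta> k) w", OF this 2(1)] show ?thesis
      using 2(2-4) 1(3) less.prems(1) by metis
  qed
qed

instance phase :: finite
proof
  have "(UNIV :: phase set) = {Load, Read, Store}"
    by (auto intro: phase.exhaust)
  then show "finite (UNIV :: phase set)"
    by (metis finite.simps)
qed

text \<open>A counter holds at most the largest head position \<open>n + 1\<close>, so
  \<open>tour_level\<close> gives \<open>2 ^ j \<le> n + 2\<close> for its head position
  \<open>j\<close>; the final 1 accounts for cell 0.\<close>

definition log_cells :: "nat \<Rightarrow> nat" where
  "log_cells n = nat \<lfloor>log 2 (real (n + 2))\<rfloor> + 1"

lemma less_log_cells:
  assumes "2 ^ j \<le> n + 2"
  shows "j < log_cells n"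
proof -
  have "real j = log 2 (2 ^ j)" by simp
  also have "(2::real) ^ j \<le> real (n + 2)" using assms by (metis of_nat_le_iff of_nat_numeral of_nat_power)
  then have "log 2 (2 ^ j) \<le> log 2 (real (n + 2))" by (subst log_le_cancel_iff) auto
  finally have "j \<le> nat \<lfloor>log 2 (real (n + 2))\<rfloor>" by (simp add: le_nat_floor)
  then show ?thesis by (simp add: log_cells_def)
qed

lemma finite_funs_on:
  fixes k :: nat
  assumes "finite A"
  shows "finite {f. (\<forall>j<k. f j \<in> A) \<and> (\<forall>j\<ge>k. f j = d)}"
proof -
  have "{f. (\<forall>j<k. f j \<in> A) \<and> (\<forall>j\<ge>k. f j = d)} =
      {f. \<forall>j. (j \<in> {..<k} \<longrightarrow> f j \<in> A) \<and> (j \<notin> {..<k} \<longrightarrow> f j = d)}"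
    by (auto simp: not_less)
  then show ?thesis using finite_set_of_finite_funs[OF finite_lessThan assms] by simp
qed

text \<open>The tapes \<open>Inl i\<close> are the original ones and \<open>Inr j\<close> is the
  counter of head \<open>j\<close>. The bound \<open>3 \<le> b\<close> makes room for the symbols of
  the counters.\<close>

lemma multihead_in_NSPACE:
  fixes \<delta> :: "'z \<Rightarrow> (nat \<Rightarrow> 'a::finite isym) \<Rightarrow> 'i obs \<Rightarrow> 'z \<times> (nat \<Rightarrow> move) \<times> 'i acts \<Rightarrow> bool"
  assumes fin: "finite Q" "finite I" and z0: "z0 \<in> Q" and b: "3 \<le> b" and k: "0 < k"
    and closed: "\<And>z x ob z' m a. z \<in> Q \<Longrightarrow> ob \<in> obs_on I {..b} \<Longrightarrow> \<forall>j\<ge>k. x j = LeftEnd \<Longrightarrow>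
      \<delta> z x ob (z', m, a) \<Longrightarrow> z' \<in> Q \<and> a \<in> acts_on I {..b} \<and> (\<forall>j\<ge>k. m j = Stay)"
    and space: "\<And>w z p T i. (multihead_step \<delta> w)\<^sup>*\<^sup>* (z0, \<lambda>_. 0, \<lambda>_. blank_tape) (z, p, T) \<Longrightarrow> i \<in> I \<Longrightarrow>
      fst (T i) < s (length w)"
  shows "{w. \<exists>z p T. (multihead_step \<delta> w)\<^sup>*\<^sup>* (z0, \<lambda>_. 0, \<lambda>_. blank_tape) (z, p, T) \<and> acc z}
    \<in> NSPACE (\<lambda>n. s n + log_cells n)"
proof -
  let ?m0 = "(z0, \<lambda>_. 0, \<lambda>_. blank_tape) :: 'z \<times> (nat \<Rightarrow> nat) \<times> 'i tapes"
  define s0 :: "('z, 'a) head_state" where "s0 = (z0, Load, 0, \<lambda>_. Stay, \<lambda>_. LeftEnd, \<lambda>_. (False, None))"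
  let ?g0 = "(s0, 0, \<lambda>_. blank_tape) :: ('z, 'a) head_state \<times> nat \<times> ('i + nat) tapes"
  define Qh :: "('z, 'a) head_state set" where "Qh = Q \<times> UNIV \<times> {..<k} \<times>
    {m. (\<forall>j<k. m j \<in> UNIV) \<and> (\<forall>j\<ge>k. m j = Stay)} \<times>
    {xs. (\<forall>j<k. xs j \<in> UNIV) \<and> (\<forall>j\<ge>k. xs j = LeftEnd)} \<times>
    {cs. (\<forall>j<k. cs j \<in> ctrls) \<and> (\<forall>j\<ge>k. cs j = (False, None))}"
  have finQh: "finite Qh"
    unfolding Qh_def by (intro finite_cartesian_product fin finite_funs_on finite_ctrls finite finite_lessThan)
  have minv: "z \<in> Q \<and> T \<in> tapes_on I {..b} \<and> (\<forall>j\<ge>k. p j = 0)"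
    if "(multihead_step \<delta> w)\<^sup>*\<^sup>* ?m0 (z, p, T)" for w z p T
    using that
  proof (induction "(z, p, T)" arbitrary: z p T rule: rtranclp_induct)
    case base
    then show ?case using z0 by (auto intro!: blank_tapes_on)
  next
    case (step y)
    obtain z1 p1 T1 where y: "y = (z1, p1, T1)" using prod_cases3 by blast
    then have 1: "z1 \<in> Q" "T1 \<in> tapes_on I {..b}" "\<forall>j\<ge>k. p1 j = 0" using step(3) by auto
    obtain m a where d: "\<delta> z1 (\<lambda>j. input_at w (p1 j)) (look \<circ> T1) (z, m, a)" and T: "T = write_all a T1"
      and p: "p = (\<lambda>j. min (length w + 1) (shift (m j) (p1 j)))"
      using step(2) y by (auto simp: multihead_step_def)
    have "z \<in> Q \<and> a \<in> acts_on I {..b} \<and> (\<forall>j\<ge>k. m j = Stay)"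
      using closed[OF 1(1) look_tapes_on[OF 1(2)] _ d] 1(3) by (simp add: input_at_def)
    then show ?case using write_all_tapes_on[OF 1(2)] T p 1(3) by auto
  qed
  have fire_moves: "\<forall>j\<ge>k. m' j = Stay"
    if "(multihead_step \<delta> w)\<^sup>*\<^sup>* ?m0 (z, p, T)" "\<delta> z (\<lambda>j. input_at w (p j)) (look \<circ> T) (z', m', a)" for w z p T z' m' a
    using closed[OF _ _ _ that(2)] minv[OF that(1)] look_tapes_on by (auto simp: input_at_def)
  have init: "head_inv w k (\<lambda>_. 0) (\<lambda>_. 0) ?g0" for w
    using k holds_blank by (auto simp: head_inv_def s0_def)
  have bwd: "\<exists>q p. head_inv w k q p y \<and>
      (multihead_step \<delta> w)\<^sup>*\<^sup>* ?m0 (fst (fst y), p, snd (snd y) \<circ> Inl)" if "(machine_step (head_sim \<delta> k) w)\<^sup>*\<^sup>* ?g0 y" for w y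
    using that
  proof (induction rule: rtranclp_induct)
    case base
    have "(multihead_step \<delta> w)\<^sup>*\<^sup>* ?m0 (z0, \<lambda>_. 0, (\<lambda>_. blank_tape) \<circ> Inl)" by (simp add: comp_def)
    then show ?case using init[of w] by (auto simp: s0_def)
  next
    case (step y y')
    obtain z ph i m xs cs h T where y: "y = ((z, ph, i, m, xs, cs), h, T)" by (metis prod.exhaust)
    obtain q p where inv: "head_inv w k q p ((z, ph, i, m, xs, cs), h, T)"
      and r: "(multihead_step \<delta> w)\<^sup>*\<^sup>* ?m0 (z, p, T \<circ> Inl)"
      using step(3) unfolding y fst_conv snd_conv by blast
    show ?case
    proof (cases "ph = Store \<and> h = 0 \<and> \<not> Suc i < k")
      case False
      obtain ph' i' xs' cs' h' T' where
        y': "y' = ((z, ph', i', m, xs', cs'), h', T')" and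
        hv: "head_inv w k q p ((z, ph', i', m, xs', cs'), h', T')" and inl: "T' \<circ> Inl = T \<circ> Inl"
        using head_sim_progress[OF inv False, of \<delta>] step(2) unfolding y by metis
      show ?thesis unfolding y' fst_conv snd_conv inl using hv r by blast
    next
      case True
      then have inv': "head_inv w k q p ((z, Store, i, m, xs, cs), 0, T)" and i: "\<not> Suc i < k" using inv by auto
      obtain z' m' a where d: "\<delta> z (\<lambda>j. input_at w (p j)) (look \<circ> (T \<circ> Inl)) (z', m', a)"
        and y': "y' = ((z', Load, 0, m', xs, cs), 0, case_sum (write_all a (T \<circ> Inl)) (T \<circ> Inr))"
        using head_sim_fire(1)[OF inv' i, of \<delta> y'] step(2) True y by auto
      have "multihead_step \<delta> w (z, p, T \<circ> Inl) (z', \<lambda>j. min (length w + 1) (shift (m' j) (p j)), write_all a (T \<circ> Inl))"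
        using d unfolding multihead_step_def by blast
      then have "(multihead_step \<delta> w)\<^sup>*\<^sup>* ?m0 (z', \<lambda>j. min (length w + 1) (shift (m' j) (p j)), write_all a (T \<circ> Inl))"
        using r by (rule rtranclp.rtrancl_into_rtrancl[rotated])
      moreover have "head_inv w k p (\<lambda>j. min (length w + 1) (shift (m' j) (p j))) y'"
        unfolding y' by (rule head_sim_fire(2)[OF inv' i fire_moves[OF r d]])
      moreover have inl: "case_sum (write_all a (T \<circ> Inl)) (T \<circ> Inr) \<circ> Inl = write_all a (T \<circ> Inl)"
        by (auto simp: comp_def)
      ultimately show ?thesis unfolding y' fst_conv snd_conv inl by blast
    qed
  qed
  have fwd: "\<exists>i m xs cs h T' q. (machine_step (head_sim \<delta> k) w)\<^sup>*\<^sup>* ?g0 ((z, Load, i, m, xs, cs), h, T') \<and>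
      head_inv w k q p ((z, Load, i, m, xs, cs), h, T') \<and> T' \<circ> Inl = T"
    if "(multihead_step \<delta> w)\<^sup>*\<^sup>* ?m0 (z, p, T)" for w z p T
    using that
  proof (induction "(z, p, T)" arbitrary: z p T rule: rtranclp_induct)
    case base
    have "(\<lambda>_. blank_tape) \<circ> Inl = (\<lambda>_. blank_tape)" by auto
    then show ?case using init[of w] unfolding s0_def by blast
  next
    case (step y)
    obtain z1 p1 T1 where y: "y = (z1, p1, T1)" using prod_cases3 by blast
    obtain m' a where d: "\<delta> z1 (\<lambda>j. input_at w (p1 j)) (look \<circ> T1) (z, m', a)" and T: "T = write_all a T1"
      and p: "p = (\<lambda>j. min (length w + 1) (shift (m' j) (p1 j)))"
      using step(2) y by (auto simp: multihead_step_def)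
    obtain i m xs cs h T' q where 1: "(machine_step (head_sim \<delta> k) w)\<^sup>*\<^sup>* ?g0 ((z1, Load, i, m, xs, cs), h, T')"
      "head_inv w k q p1 ((z1, Load, i, m, xs, cs), h, T')" "T' \<circ> Inl = T1"
      using step(3)[OF y] by blast
    obtain i2 xs2 cs2 T2 where 2:
      "(machine_step (head_sim \<delta> k) w)\<^sup>*\<^sup>* ((z1, Load, i, m, xs, cs), h, T') ((z1, Store, i2, m, xs2, cs2), 0, T2)"
      "head_inv w k q p1 ((z1, Store, i2, m, xs2, cs2), 0, T2)" "\<not> Suc i2 < k" "T2 \<circ> Inl = T' \<circ> Inl"
      using head_sim_reach_fire[OF 1(2)] by blast
    have T2: "T2 \<circ> Inl = T1" using 2(4) 1(3) by simp
    have "machine_step (head_sim \<delta> k) w ((z1, Store, i2, m, xs2, cs2), 0, T2)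
        ((z, Load, 0, m', xs2, cs2), 0, case_sum (write_all a (T2 \<circ> Inl)) (T2 \<circ> Inr))"
      unfolding head_sim_fire(1)[OF 2(2,3)] T2 using d by blast
    with 1(1) 2(1) have "(machine_step (head_sim \<delta> k) w)\<^sup>*\<^sup>* ?g0
        ((z, Load, 0, m', xs2, cs2), 0, case_sum (write_all a (T2 \<circ> Inl)) (T2 \<circ> Inr))"
      by (meson rtranclp.rtrancl_into_rtrancl rtranclp_trans)
    moreover have "head_inv w k p1 p
        ((z, Load, 0, m', xs2, cs2), 0, case_sum (write_all a (T2 \<circ> Inl)) (T2 \<circ> Inr))"
      unfolding p using step(1) d unfolding y by (intro head_sim_fire(2)[OF 2(2,3)] fire_moves)
    moreover have "case_sum (write_all a (T2 \<circ> Inl)) (T2 \<circ> Inr) \<circ> Inl = T"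
      using T T2 by (auto simp: comp_def)
    ultimately show ?case by blast
  qed
  have "{w. \<exists>z h T. (machine_step (head_sim \<delta> k) w)\<^sup>*\<^sup>* ?g0 (z, h, T) \<and> (acc \<circ> fst) z}
      \<in> NSPACE (\<lambda>n. s n + log_cells n)"
  proof (rule machine_in_NSPACE)
    show "finite Qh" "finite {..b}" "finite (I <+> {..<k})" "0 \<in> {..b}"
      using finQh fin by auto
    show "s0 \<in> Qh" using z0 k by (auto simp: s0_def Qh_def ctrls_def)
  next
    fix z x ob z' m a
    assume z: "z \<in> Qh" and ob: "ob \<in> obs_on (I <+> {..<k}) {..b}" and h: "head_sim \<delta> k z x ob (z', m, a)"
    obtain y ph i mv xs cs where zz: "z = (y, ph, i, mv, xs, cs)" by (metis prod_cases3)
    have i: "i < k" "y \<in> Q" "cs i \<in> ctrls" using z by (auto simp: zz Qh_def)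
    obtain fl v where v: "ob (Inr i) = (fl, v)" "v \<le> b"
      using ob i by (cases "ob (Inr i)") (auto simp: obs_on_def dest!: spec[of _ "Inr i"])
    have idl: "idle ob \<in> acts_on (I <+> {..<k}) {..b}" using idle_on[OF ob] .
    have upd: "(idle ob)(Inr i := e) \<in> acts_on (I <+> {..<k}) {..b}" if "fst e \<le> b" for e
      using idl that i by (auto simp: acts_on_def mem_Times_iff)
    show "z' \<in> Qh \<and> a \<in> acts_on (I <+> {..<k}) {..b}"
    proof (cases ph)
      case Load
      obtain c e1 e2 where c: "cuntick (cs i) (fl, v) = (c, e1, e2)" by (metis prod_cases3)
      show ?thesis
        using h z cuntick_closed[OF i(3) v(2) b c] upd[of "(e1, e2)"] idl
        by (auto simp: zz Load v c Qh_def split: if_splits)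
    next
      case Read
      then show ?thesis using h z idl i by (auto simp: zz Qh_def)
    next
      case Store
      obtain c e1 e2 where c: "ctick (cs i) (fl, v) = (c, e1, e2)" by (metis prod_cases3)
      have obl: "ob \<circ> Inl \<in> obs_on I {..b}"
        using ob by (auto simp: obs_on_def)
      have fr: "case_sum a1 (idle ob \<circ> Inr) \<in> acts_on (I <+> {..<k}) {..b}"
        if "a1 \<in> acts_on I {..b}" for a1
        using idl that by (auto simp: acts_on_def split: sum.split)
      show ?thesis
        using h z ctick_closed[OF i(3) v(2) b c] upd[of "(e1, e2)"] idl closed[OF i(2) obl, of xs] fr k
        by (auto simp: zz Store v c Qh_def split: if_splits)
    qed
  next
    fix w z h T i assume r: "(machine_step (head_sim \<delta> k) w)\<^sup>*\<^sup>* ?g0 (z, h, T)" and i: "i \<in> I <+> {..<k}"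
    obtain y ph i' m xs cs q p where hi: "head_inv w k q p ((y, ph, i', m, xs, cs), h, T)"
      and mr: "(multihead_step \<delta> w)\<^sup>*\<^sup>* ?m0 (y, p, T \<circ> Inl)"
      using bwd[OF r] unfolding fst_conv snd_conv by (cases z) (simp only: fst_conv, blast)
    show "fst (T i) < s (length w) + log_cells (length w)"
    proof (cases i)
      case (Inl j)
      then show ?thesis using space[OF mr, of j] i by auto
    next
      case (Inr j)
      then have j: "j < k" using i by auto
      have q: "q j \<le> length w + 1" "p j \<le> length w + 1" using hi j by (auto simp: head_inv_def)
      \<comment> \<open>The counter of the head in transit holds only the part of the position that
        the real head has not covered; all other counters hold a full position.\<close>
      have "\<exists>v. v \<le> length w + 1 \<and> holds v (cs j) (T (Inr j))"
      proof (cases "i' = j")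
        case True
        have "\<exists>v. holds v (cs j) (T (Inr j)) \<and> (h + v = q j \<or> h + v = p j \<or> v = 0)"
          using hi unfolding True head_inv_def by (cases ph) auto
        then show ?thesis using q by (metis add_leE le0)
      next
        case False
        then have "j < i' \<or> i' < j" by auto
        moreover have "j < i' \<Longrightarrow> holds (p j) (cs j) (T (Inr j))"
          and "i' < j \<Longrightarrow> holds (q j) (cs j) (T (Inr j))"
          using hi j unfolding head_inv_def prod.case by blast+
        ultimately show ?thesis using q by blast
      qed
      then obtain v where v: "v \<le> length w + 1" "holds v (cs j) (T (Inr j))" by blast
      have "2 ^ fst (T (Inr j)) \<le> length w + 2"
        using holds_level[OF v(2)] v(1) by simp
      then show ?thesis
        using less_log_cells unfolding Inr by (simp add: trans_less_add2)
    qed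
  qed
  also have "{w. \<exists>z h T. (machine_step (head_sim \<delta> k) w)\<^sup>*\<^sup>* ?g0 (z, h, T) \<and> (acc \<circ> fst) z} =
      {w. \<exists>z p T. (multihead_step \<delta> w)\<^sup>*\<^sup>* ?m0 (z, p, T) \<and> acc z}"
  proof (intro set_eqI iffI)
    fix w assume "w \<in> {w. \<exists>z h T. (machine_step (head_sim \<delta> k) w)\<^sup>*\<^sup>* ?g0 (z, h, T) \<and> (acc \<circ> fst) z}"
    then obtain z h T where "(machine_step (head_sim \<delta> k) w)\<^sup>*\<^sup>* ?g0 (z, h, T)" "acc (fst z)" by auto
    then show "w \<in> {w. \<exists>z p T. (multihead_step \<delta> w)\<^sup>*\<^sup>* ?m0 (z, p, T) \<and> acc z}"
      using bwd[of w "(z, h, T)"] by auto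
  next
    fix w assume "w \<in> {w. \<exists>z p T. (multihead_step \<delta> w)\<^sup>*\<^sup>* ?m0 (z, p, T) \<and> acc z}"
    then obtain z p T where "(multihead_step \<delta> w)\<^sup>*\<^sup>* ?m0 (z, p, T)" "acc z" by blast
    then show "w \<in> {w. \<exists>z h T. (machine_step (head_sim \<delta> k) w)\<^sup>*\<^sup>* ?g0 (z, h, T) \<and> (acc \<circ> fst) z}"
      using fwd[of w z p T] by force
  qed
  finally show ?thesis .
qed

section \<open>Comparing public memories from finite logs\<close>

type_synonym 'a view = "nat \<times> 'a isym \<times> (bool \<times> nat) list"
type_synonym 'a log = "('a view \<times> action) list"

text \<open>The left-end bits are recorded because \<open>MoveL\<close> has no effect at cell 0.
  With them a log determines by how much each work head moves.\<close>

fun view :: "'a list \<Rightarrow> mem \<Rightarrow> 'a view" where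
  "view w (q, h, ts) = (q, input_at w h, map look ts)"

fun log_ok :: "'a list \<Rightarrow> 'a log \<Rightarrow> mem \<Rightarrow> bool" where
  "log_ok w [] c \<longleftrightarrow> True"
| "log_ok w ((v, a) # lg) c \<longleftrightarrow> view w c = v \<and> length (snd (snd a)) = length (snd (snd c)) \<and>
     log_ok w lg (update w a c)"

fun log_run :: "'a list \<Rightarrow> 'a log \<Rightarrow> mem \<Rightarrow> mem" where
  "log_run w [] c = c"
| "log_run w ((v, a) # lg) c = log_run w lg (update w a c)"

lemma log_run_snoc: "log_run w (lg @ [(v, a)]) c = update w a (log_run w lg c)"
  by (induction w lg c rule: log_run.induct) auto

lemma log_ok_snoc: "log_ok w (lg @ [(v, a)]) c \<longleftrightarrow> log_ok w lg c \<and> view w (log_run w lg c) = v \<and>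
    length (snd (snd a)) = length (snd (snd (log_run w lg c)))"
  by (induction w lg c rule: log_run.induct) auto

definition mem_ok :: "nat \<Rightarrow> 'a list \<Rightarrow> mem \<Rightarrow> bool" where
  "mem_ok P w c \<longleftrightarrow> fst (snd c) \<le> length w + 1 \<and> length (snd (snd c)) = P"

lemma mem_ok_update:
  "mem_ok P w c \<Longrightarrow> length (snd (snd a)) = P \<Longrightarrow> mem_ok P w (update w a c)"
  by (cases c; cases a) (auto simp: mem_ok_def)

text \<open>
  Whether two logs lead from a common memory to the same memory is a property of the logs alone
  (\<open>same_result_iff\<close>): a cell changed by one of them has been observed by it. Hence the existential
  quantifier is harmless, and a finite control can decide equality.
\<close>

definition same_result :: "nat \<Rightarrow> 'a log \<Rightarrow> 'a log \<Rightarrow> bool" where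
  "same_result P lg lg' \<longleftrightarrow> (\<exists>w c. mem_ok P w c \<and> log_ok w lg c \<and> log_ok w lg' c \<and>
     log_run w lg c = log_run w lg' c)"

text \<open>
  A cell before and after a log, in two runs of the same log: either untouched in both runs, or
  visited, and then equal in both runs at either time.
\<close>

definition cell_rel :: "'b \<Rightarrow> 'b \<Rightarrow> 'b \<Rightarrow> 'b \<Rightarrow> bool" where
  "cell_rel x y x' y' \<longleftrightarrow> (y = x \<and> y' = x') \<or> (x = x' \<and> y = y')"

text \<open>Cells are matched by their distance from the initial heads, so the two tapes may be
  shifted against each other. A cell whose partner would lie beyond the left end cannot have been
  visited, because the other run makes the same moves; it is unchanged.\<close>

definition tape_rel :: "tape \<Rightarrow> tape \<Rightarrow> tape \<Rightarrow> tape \<Rightarrow> bool" where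
  "tape_rel = (\<lambda>(h, f) (k, g) (h', f') (k', g'). int k' - int k = int h' - int h \<and>
     (\<forall>p p'. int p' - int p = int h' - int h \<longrightarrow> cell_rel (f p) (g p) (f' p') (g' p')) \<and>
     (\<forall>p. int p + (int h' - int h) < 0 \<longrightarrow> g p = f p) \<and>
     (\<forall>p'. int p' - (int h' - int h) < 0 \<longrightarrow> g' p' = f' p'))"

lemma tape_rel_refl: "tape_rel t t t' t'"
  by (cases t; cases t') (auto simp: tape_rel_def cell_rel_def)

lemma tape_rel_step:
  assumes "tape_rel (write_move e t) u (write_move e t') u'" and "look t = look t'"
  shows "tape_rel t u t' u'"
proof -
  obtain h f where t: "t = (h, f)" by fastforce
  obtain h' f' where t': "t' = (h', f')" by fastforce
  obtain k g where u: "u = (k, g)" by fastforce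
  obtain k' g' where u': "u' = (k', g')" by fastforce
  obtain x m where e: "e = (x, m)" by fastforce
  have l: "h = 0 \<longleftrightarrow> h' = 0" "f h = f' h'" using assms(2) by (auto simp: t t' look_pair)
  \<comment> \<open>Equal left-end bits: a move to the left is blocked in both runs or in
    neither.\<close>
  have d: "int (shift m h') - int (shift m h) = int h' - int h"
    using l(1) by (cases m) auto
  have 1: "int k' - int k = int h' - int h"
    "\<And>p p'. int p' - int p = int h' - int h \<Longrightarrow> cell_rel ((f(h := x)) p) (g p) ((f'(h' := x)) p') (g' p')"
    "\<And>p. int p + (int h' - int h) < 0 \<Longrightarrow> g p = (f(h := x)) p"
    "\<And>p'. int p' - (int h' - int h) < 0 \<Longrightarrow> g' p' = (f'(h' := x)) p'"
    using assms(1) d by (auto simp: tape_rel_def t t' u u' e)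
  \<comment> \<open>The scanned cells start with equal symbols and are overwritten equally; whether
    or not the rest of the log visits them again, they end equal.\<close>
  have 2: "cell_rel (f p) (g p) (f' p') (g' p')" if "int p' - int p = int h' - int h" for p p'
  proof (cases "p = h")
    case True
    then have "p' = h'" using that by simp
    then show ?thesis using 1(2)[OF that] True l(2) by (auto simp: cell_rel_def)
  next
    case False
    then have "p' \<noteq> h'" using that by auto
    then show ?thesis using 1(2)[OF that] False by simp
  qed
  have 3: "g p = f p" if "int p + (int h' - int h) < 0" for p
    using 1(3)[OF that] that by (auto split: if_splits)
  have 4: "g' p = f' p" if "int p - (int h' - int h) < 0" for p
    using 1(4)[OF that] that by (auto split: if_splits)
  show ?thesis using 1(1) 2 3 4 by (auto simp: tape_rel_def t t' u u')
qed

lemma cell_rel_join: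
  "cell_rel x y x' y' \<Longrightarrow> cell_rel x y x' z' \<Longrightarrow> y' = z'"
  by (auto simp: cell_rel_def)

text \<open>A reference run from \<open>t\<close> to \<open>u\<close> determines the result on
  \<open>t'\<close>: a cell keeps its contents from \<open>t'\<close> or takes them from
  \<open>u\<close>, and where both readings are possible they give the same symbol.\<close>

lemma tape_rel_join:
  assumes "tape_rel t u t' u1" "tape_rel t u t' u2"
  shows "u1 = u2"
proof -
  obtain h f where t: "t = (h, f)" by fastforce
  obtain h' f' where t': "t' = (h', f')" by fastforce
  obtain k g where u: "u = (k, g)" by fastforce
  obtain k1 g1 where u1: "u1 = (k1, g1)" by fastforce
  obtain k2 g2 where u2: "u2 = (k2, g2)" by fastforce
  have "k1 = k2" using assms by (auto simp: tape_rel_def t t' u u1 u2)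
  moreover have "g1 p' = g2 p'" for p'
  proof (cases "int p' - (int h' - int h) < 0")
    case True
    then show ?thesis using assms by (auto simp: tape_rel_def t t' u u1 u2)
  next
    case False
    define p where "p = nat (int p' - (int h' - int h))"
    have "int p' - int p = int h' - int h" using False by (simp add: p_def)
    then show ?thesis using assms cell_rel_join[of "f p" "g p" "f' p'" "g1 p'" "g2 p'"]
      by (auto simp: tape_rel_def t t' u u1 u2)
  qed
  ultimately show ?thesis by (auto simp: u1 u2)
qed

text \<open>The control state is treated as one more cell. The input head is compared only by its
  displacement, as the inputs may differ.\<close>

definition mem_rel :: "mem \<Rightarrow> mem \<Rightarrow> mem \<Rightarrow> mem \<Rightarrow> bool" where
  "mem_rel = (\<lambda>(q, h, ts) (r, k, us) (q', h', ts') (r', k', us'). cell_rel q r q' r' \<and>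
     int k' - int k = int h' - int h \<and> length us = length ts \<and> length ts' = length ts \<and> length us' = length ts \<and>
     (\<forall>j<length ts. tape_rel (ts ! j) (us ! j) (ts' ! j) (us' ! j)))"

text \<open>The end markers reveal whether a move is blocked, even when the inputs have different
  lengths.\<close>

lemma input_at_clamp:
  assumes "input_at w h = input_at w' h'" "h \<le> length w + 1" "h' \<le> length w' + 1"
  shows "int (min (length w' + 1) (shift m h')) - int (min (length w + 1) (shift m h)) = int h' - int h"
  using assms by (cases m) (auto simp: input_at_def split: if_splits)

text \<open>The two runs may have unrelated inputs and memories; all that they share is the log.
  This generality is needed because the witness in \<open>same_result\<close> is arbitrary.\<close>

lemma log_run_rel:
  assumes "mem_ok P w c" "mem_ok P w' c'" "log_ok w lg c" "log_ok w' lg c'"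
  shows "mem_rel c (log_run w lg c) c' (log_run w' lg c')"
  using assms
proof (induction lg arbitrary: c c')
  case Nil
  then show ?case
    by (cases c; cases c') (auto simp: mem_rel_def mem_ok_def cell_rel_def tape_rel_refl)
next
  case (Cons e lg)
  obtain v qa m as where e: "e = (v, qa, m, as)" by (metis prod.exhaust)
  obtain q h ts where c: "c = (q, h, ts)" by (metis prod.exhaust)
  obtain q' h' ts' where c': "c' = (q', h', ts')" by (metis prod.exhaust)
  have ok: "mem_ok P w (update w (qa, m, as) c)" "mem_ok P w' (update w' (qa, m, as) c')"
    by (rule mem_ok_update, use Cons.prems e in \<open>simp add: mem_ok_def\<close>,
        use Cons.prems e in \<open>simp add: mem_ok_def\<close>)+
  have IH: "mem_rel (update w (qa, m, as) c) (log_run w (e # lg) c) (update w' (qa, m, as) c') (log_run w' (e # lg) c')"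
    using Cons.IH[OF ok] Cons.prems e by simp
  have v: "q = q'" "input_at w h = input_at w' h'" "map look ts = map look ts'" "length as = length ts"
    using Cons.prems by (auto simp: e c c')
  have len: "length ts' = length ts" using v(3) by (metis length_map)
  obtain r k us where d: "log_run w (e # lg) c = (r, k, us)" by (metis prod.exhaust)
  obtain r' k' us' where d': "log_run w' (e # lg) c' = (r', k', us')" by (metis prod.exhaust)
  note R = IH[unfolded d d', unfolded c c' mem_rel_def update.simps prod.case]
  have "int k' - int k = int h' - int h"
    using R input_at_clamp[OF v(2), of m] Cons.prems(1,2) by (auto simp: mem_ok_def c c')
  moreover have "cell_rel q r q' r'" using R v(1) by (auto simp: cell_rel_def)
  moreover have "tape_rel (ts ! j) (us ! j) (ts' ! j) (us' ! j)" if j: "j < length ts" for j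
  proof (rule tape_rel_step)
    show "tape_rel (write_move (as ! j) (ts ! j)) (us ! j) (write_move (as ! j) (ts' ! j)) (us' ! j)"
      using R j v(4) len by simp
    show "look (ts ! j) = look (ts' ! j)" using v(3) j len by (metis nth_map)
  qed
  ultimately show ?case
    using R v(4) len unfolding d d' unfolding c c' mem_rel_def by simp
qed

lemma mem_rel_join:
  assumes "mem_rel c d c' d1" "mem_rel c d c' d2"
  shows "d1 = d2"
proof -
  obtain q h ts where c: "c = (q, h, ts)" by (metis prod.exhaust)
  obtain q' h' ts' where c': "c' = (q', h', ts')" by (metis prod.exhaust)
  obtain r k us where d: "d = (r, k, us)" by (metis prod.exhaust)
  obtain r1 k1 us1 where d1: "d1 = (r1, k1, us1)" by (metis prod.exhaust)
  obtain r2 k2 us2 where d2: "d2 = (r2, k2, us2)" by (metis prod.exhaust)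
  have "us1 = us2"
  proof (rule nth_equalityI)
    show "length us1 = length us2" using assms by (auto simp: mem_rel_def c c' d d1 d2)
    show "us1 ! j = us2 ! j" if "j < length us1" for j
      using assms that tape_rel_join[of "ts ! j" "us ! j" "ts' ! j"] by (simp add: mem_rel_def c c' d d1 d2)
  qed
  moreover have "r1 = r2" using assms cell_rel_join[of q r q' r1 r2] by (auto simp: mem_rel_def c c' d d1 d2)
  moreover have "k1 = k2" using assms by (auto simp: mem_rel_def c c' d d1 d2)
  ultimately show ?thesis by (simp add: d1 d2)
qed

text \<open>In the witness run both logs lead to one memory. The two results from \<open>c\<close>
  are related to this same transition, so \<open>mem_rel_join\<close> identifies them.\<close>

lemma same_result_iff:
  assumes "mem_ok P w c" "log_ok w lg c" "log_ok w lg' c"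
  shows "same_result P lg lg' \<longleftrightarrow> log_run w lg c = log_run w lg' c"
proof
  assume "same_result P lg lg'"
  then obtain w' :: "'a list" and c' where 1: "mem_ok P w' c'" "log_ok w' lg c'" "log_ok w' lg' c'"
      "log_run w' lg c' = log_run w' lg' c'"
    by (auto simp: same_result_def)
  have "mem_rel c' (log_run w' lg c') c (log_run w lg c)"
    using log_run_rel[OF 1(1) assms(1) 1(2) assms(2)] .
  moreover have "mem_rel c' (log_run w' lg c') c (log_run w lg' c)"
    using log_run_rel[OF 1(1) assms(1) 1(3) assms(3)] 1(4) by simp
  ultimately show "log_run w lg c = log_run w lg' c" by (rule mem_rel_join)
next
  assume "log_run w lg c = log_run w lg' c"
  then show "same_result P lg lg'" using assms unfolding same_result_def by blast
qed

section \<open>Following all choice sequences simultaneously\<close>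

text \<open>
  Every slot plays one copy of the game, with the universal moves dictated by a fixed list of
  rules; it is won as soon as the next rule of the list does not apply. All slots make their
  existential moves at the same time. The relation \<open>E\<close> contains the pairs of slots that the
  existential player cannot tell apart; they have to make the same move. The log of a slot lists
  its universal moves since the last existential turn.
\<close>

type_synonym 'a rule = "('a trigger \<times> priv_trigger) \<times> (mode \<times> action \<times> priv_action)"
type_synonym 'a aux = "mode \<times> 'a rule list \<times> 'a log"
type_synonym 'a decision = "'a aux \<times> action \<times> priv_action"

fun view_trigger :: "'a view \<Rightarrow> 'a trigger" where
  "view_trigger (q, x, ls) = (q, x, map snd ls)"

lemma view_trigger: "view_trigger (view w c) = observe w c"
  by (cases c) (auto simp: look_def)

fun idle_action :: "'a trigger \<Rightarrow> action" where
  "idle_action (q, x, ys) = (q, Stay, map (\<lambda>y. (y, Stay)) ys)"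

fun idle_priv :: "priv_trigger \<Rightarrow> priv_action" where
  "idle_priv (r, ys) = (r, map (\<lambda>y. (y, Stay)) ys)"

lemma map2_idle: "map2 (\<lambda>x y. write_move x y) (map (\<lambda>y. (y, Stay)) (map scan ts)) ts = ts"
proof -
  have "write_move (scan t, Stay) t = t" for t by (cases t) simp
  then show ?thesis by (induction ts) auto
qed

lemma update_idle: "mem_ok P w c \<Longrightarrow> update w (idle_action (observe w c)) c = c"
  using map2_idle by (cases c) (auto simp: mem_ok_def)

lemma priv_update_idle: "priv_update (idle_priv (priv_observe d)) d = d"
  using map2_idle by (cases d) auto

text \<open>Counting an exhausted list as won loses nothing: a further universal move is dictated by
  a longer list, and after \<open>K\<close> universal moves there is none.\<close>

fun univ_decision :: "'a aux \<Rightarrow> 'a view \<Rightarrow> priv_trigger \<Rightarrow> 'a decision" where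
  "univ_decision (md, u, lg) v pt =
     (case (md, u) of
        (Univ, ((t, pt'), (md', a, b)) # u') \<Rightarrow>
          if t = view_trigger v \<and> pt' = pt then ((md', u', lg @ [(v, a)]), a, b)
          else ((Accept, u, lg), idle_action (view_trigger v), idle_priv pt)
      | (Univ, []) \<Rightarrow> ((Accept, u, lg), idle_action (view_trigger v), idle_priv pt)
      | _ \<Rightarrow> ((md, u, lg), idle_action (view_trigger v), idle_priv pt))"

fun exist_decision :: "mode \<times> action \<Rightarrow> 'a aux \<Rightarrow> 'a view \<Rightarrow> priv_trigger \<Rightarrow> 'a decision" where
  "exist_decision (md', a) (md, u, lg) v pt =
     (if md = Exist then ((md', u, []), a, idle_priv pt)
      else ((md, u, lg), idle_action (view_trigger v), idle_priv pt))"

text \<open>Comparing logs is legitimate since slots related by \<open>E\<close> had equal public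
  memories when their logs were last emptied. Slots already won drop out, as they make no more
  moves.\<close>

definition indist :: "nat \<Rightarrow> (nat \<Rightarrow> 'a aux) \<Rightarrow> (nat \<times> nat) set \<Rightarrow> (nat \<times> nat) set" where
  "indist P A E = {(i, j) \<in> E. fst (A i) = Exist \<and> fst (A j) = Exist \<and>
     same_result P (snd (snd (A i))) (snd (snd (A j)))}"

text \<open>The second alternative waits until no slot is universal, which synchronises the
  existential turns. A slot in mode \<open>Reject\<close> blocks it for good, so such a run never
  accepts.\<close>

definition decide :: "'a patm \<Rightarrow> nat \<Rightarrow> (nat \<Rightarrow> 'a aux) \<Rightarrow> (nat \<Rightarrow> 'a view) \<Rightarrow> (nat \<Rightarrow> priv_trigger) \<Rightarrow>
    (nat \<times> nat) set \<Rightarrow> (nat \<Rightarrow> 'a decision) \<Rightarrow> (nat \<times> nat) set \<Rightarrow> bool" where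
  "decide M N A V W E R E' \<longleftrightarrow>
     ((\<exists>i<N. fst (A i) = Univ) \<and> E' = E \<and> (\<forall>i<N. R i = univ_decision (A i) (V i) (W i))) \<or>
     ((\<forall>i<N. fst (A i) \<in> {Exist, Accept}) \<and> E' = indist (pub_tapes M) A E \<and>
      (\<exists>\<mu>. (\<forall>i<N. fst (A i) = Exist \<longrightarrow> (view_trigger (V i), \<mu> i) \<in> ex_rules M) \<and>
         (\<forall>(i, j)\<in>E'. \<mu> i = \<mu> j) \<and>
         (\<forall>i<N. R i = exist_decision (\<mu> i) (A i) (V i) (W i))))"

type_synonym 'a family = "(nat \<Rightarrow> 'a aux) \<times> (nat \<Rightarrow> mem) \<times> (nat \<Rightarrow> priv_mem) \<times> (nat \<times> nat) set"

definition family_step :: "'a patm \<Rightarrow> nat \<Rightarrow> 'a list \<Rightarrow> 'a family \<Rightarrow> 'a family \<Rightarrow> bool" where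
  "family_step M N w X Y \<longleftrightarrow> (\<exists>A C D E R E'. X = (A, C, D, E) \<and>
     decide M N A (\<lambda>i. view w (C i)) (\<lambda>i. priv_observe (D i)) E R E' \<and>
     Y = (\<lambda>i. fst (R i), \<lambda>i. update w (fst (snd (R i))) (C i),
       \<lambda>i. priv_update (snd (snd (R i))) (D i), E'))"

section \<open>Slots stay on computations of the given machine\<close>

text \<open>The mode \<open>Accept\<close> may hide a universal configuration at which the dictated
  rule did not apply. The memories are still those of a genuine computation, and so the space bound
  of \<open>M\<close> carries over.\<close>

fun slot_inv :: "'a patm \<Rightarrow> 'a list \<Rightarrow> 'a aux \<Rightarrow> mem \<Rightarrow> priv_mem \<Rightarrow> bool" where
  "slot_inv M w (md, u, lg) c d \<longleftrightarrow> set u \<subseteq> un_rules M \<and>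
     (\<exists>k md'. patm_reach M w k (md', c, d) \<and> (md = md' \<or> md = Accept))"

lemma ex_rule_length:
  assumes "patm_wf M" "(t, (md, a)) \<in> ex_rules M"
  shows "length (snd (snd a)) = pub_tapes M"
proof -
  have "\<forall>(_, (_, (_, _, as)))\<in>ex_rules M. length as = pub_tapes M"
    using assms(1) by (simp add: patm_wf_def)
  from bspec[OF this assms(2)] show ?thesis by (cases a) simp
qed

lemma un_rule_length:
  assumes "patm_wf M" "(t, (md, a, b)) \<in> un_rules M"
  shows "length (snd (snd a)) = pub_tapes M" "length (snd b) = priv_tapes M"
proof -
  have "\<forall>(_, (_, (_, _, as), (_, bs)))\<in>un_rules M. length as = pub_tapes M \<and> length bs = priv_tapes M"
    using assms(1) by (simp add: patm_wf_def)
  from bspec[OF this assms(2)] show "length (snd (snd a)) = pub_tapes M" "length (snd b) = priv_tapes M"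
    by (cases a; cases b; simp)+
qed

lemma slot_inv_Accept: "slot_inv M w (md, u, lg) c d \<Longrightarrow> slot_inv M w (Accept, u, lg) c d"
  unfolding slot_inv.simps by blast

lemma patm_reach_shape:
  assumes "patm_wf M" and "patm_reach M w k x"
  shows "mem_ok (pub_tapes M) w (fst (snd x)) \<and> length (snd (snd (snd x))) = priv_tapes M"
  using assms(2)
proof induction
  case reach_init
  then show ?case by (simp add: init_config_def mem_ok_def)
next
  case (reach_exist k c d md a)
  then show ?case
    using mem_ok_update[of "pub_tapes M" w c a] ex_rule_length[OF assms(1)] by (simp del: update.simps)
next
  case (reach_univ k c d md a b)
  then show ?case
    using mem_ok_update[of "pub_tapes M" w c a] un_rule_length[OF assms(1) reach_univ(2)]
    by (cases d; cases b) (simp del: update.simps)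
qed

lemma slot_inv_shape:
  assumes "patm_wf M" and "slot_inv M w x c d"
  shows "mem_ok (pub_tapes M) w c" "length (snd d) = priv_tapes M"
proof -
  obtain k md' where "patm_reach M w k (md', c, d)"
    using assms(2) by (cases x) auto
  from patm_reach_shape[OF assms(1) this]
  show "mem_ok (pub_tapes M) w c" "length (snd d) = priv_tapes M" by simp_all
qed

lemma univ_decision_inv:
  assumes "patm_wf M" "slot_inv M w x c d" "univ_decision x (view w c) (priv_observe d) = (x', a, b)"
  shows "slot_inv M w x' (update w a c) (priv_update b d) \<and>
    length (snd (snd a)) = pub_tapes M \<and> length (snd b) = priv_tapes M"
proof -
  obtain md u lg where x: "x = (md, u, lg)" by (metis prod.exhaust)
  note ok = slot_inv_shape[OF assms(1,2)]
  have idl: "length (snd (snd (idle_action (observe w c)))) = pub_tapes M"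
    "length (snd (idle_priv (priv_observe d))) = priv_tapes M"
    using ok by (cases c; cases d; auto simp: mem_ok_def)+
  consider (idle) "x' = x \<or> x' = (Accept, u, lg)" "a = idle_action (observe w c)" "b = idle_priv (priv_observe d)"
    | (move) t pt md' u' where "md = Univ" "u = ((t, pt), (md', a, b)) # u'" "t = observe w c" "pt = priv_observe d"
      "x' = (md', u', lg @ [(view w c, a)])"
    using assms(3) by (auto simp: x view_trigger split: mode.splits list.splits prod.splits if_splits)
  then show ?thesis
  proof cases
    case idle
    then show ?thesis
      using assms(2) idl slot_inv_Accept[OF assms(2)[unfolded x]] unfolding x
      by (auto simp: update_idle[OF ok(1)] priv_update_idle simp del: slot_inv.simps)
  next
    case move
    then have r: "((observe w c, priv_observe d), (md', a, b)) \<in> un_rules M" "set u' \<subseteq> un_rules M"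
      using assms(2) by (auto simp: x)
    obtain k where "patm_reach M w k (Univ, c, d)" using assms(2) move by (auto simp: x)
    from reach_univ[OF this r(1)] have "slot_inv M w x' (update w a c) (priv_update b d)"
      using r(2) move by auto
    moreover have "length (snd (snd a)) = pub_tapes M" "length (snd b) = priv_tapes M"
      using un_rule_length[OF assms(1) r(1)] .
    ultimately show ?thesis by blast
  qed
qed

lemma exist_decision_inv:
  assumes "patm_wf M" "slot_inv M w x c d" "exist_decision \<mu> x (view w c) (priv_observe d) = (x', a, b)"
    and "fst x = Exist \<Longrightarrow> (observe w c, \<mu>) \<in> ex_rules M"
  shows "slot_inv M w x' (update w a c) (priv_update b d) \<and>
    length (snd (snd a)) = pub_tapes M \<and> length (snd b) = priv_tapes M"
proof -
  obtain md u lg where x: "x = (md, u, lg)" by (metis prod.exhaust)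
  note ok = slot_inv_shape[OF assms(1,2)]
  have idl: "length (snd (snd (idle_action (observe w c)))) = pub_tapes M"
    "length (snd (idle_priv (priv_observe d))) = priv_tapes M"
    using ok by (cases c; cases d; auto simp: mem_ok_def)+
  show ?thesis
  proof (cases "md = Exist")
    case False
    then show ?thesis using assms(2,3) idl
      by (cases \<mu>) (auto simp: x view_trigger update_idle[OF ok(1)] priv_update_idle simp del: slot_inv.simps)
  next
    case True
    obtain md' a' where mu: "\<mu> = (md', a')" by (rule prod.exhaust)
    have r: "(observe w c, (md', a')) \<in> ex_rules M" using assms(4) True by (simp add: x mu)
    obtain k where "patm_reach M w k (Exist, c, d)" using assms(2) True by (auto simp: x)
    from reach_exist[OF this r] have "slot_inv M w (md', u, []) (update w a' c) d"
      using assms(2) unfolding x slot_inv.simps by blast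
    moreover have "length (snd (snd a')) = pub_tapes M"
      using ex_rule_length[OF assms(1) r] .
    ultimately show ?thesis using assms(3) True idl by (auto simp: x mu priv_update_idle simp del: slot_inv.simps)
  qed
qed

fun family_inv :: "'a patm \<Rightarrow> nat \<Rightarrow> 'a list \<Rightarrow> 'a family \<Rightarrow> bool" where
  "family_inv M N w (A, C, D, E) \<longleftrightarrow> (\<forall>i<N. slot_inv M w (A i) (C i) (D i)) \<and> E \<subseteq> {..<N} \<times> {..<N}"

lemma decide_inv:
  assumes "patm_wf M" "family_inv M N w (A, C, D, E)"
    and "decide M N A (\<lambda>i. view w (C i)) (\<lambda>i. priv_observe (D i)) E R E'" and "i < N"
  shows "slot_inv M w (fst (R i)) (update w (fst (snd (R i))) (C i)) (priv_update (snd (snd (R i))) (D i)) \<and>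
    length (snd (snd (fst (snd (R i))))) = pub_tapes M \<and> length (snd (snd (snd (R i)))) = priv_tapes M"
proof -
  obtain x' a b where R: "R i = (x', a, b)" by (metis prod.exhaust)
  have s: "slot_inv M w (A i) (C i) (D i)"
    using assms(2,4) unfolding family_inv.simps by blast
  consider (univ) "\<forall>i<N. R i = univ_decision (A i) (view w (C i)) (priv_observe (D i))"
    | (exist) \<mu> where "\<forall>i<N. fst (A i) = Exist \<longrightarrow> (view_trigger (view w (C i)), \<mu> i) \<in> ex_rules M"
      "\<forall>i<N. R i = exist_decision (\<mu> i) (A i) (view w (C i)) (priv_observe (D i))"
    using assms(3) unfolding decide_def by (elim disjE conjE exE)
  then show ?thesis
  proof cases
    case univ
    have "univ_decision (A i) (view w (C i)) (priv_observe (D i)) = (x', a, b)"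
      unfolding univ[rule_format, OF assms(4), symmetric] by (rule R)
    from univ_decision_inv[OF assms(1) s this] show ?thesis unfolding R fst_conv snd_conv .
  next
    case exist
    have 1: "exist_decision (\<mu> i) (A i) (view w (C i)) (priv_observe (D i)) = (x', a, b)"
      unfolding exist(2)[rule_format, OF assms(4), symmetric] by (rule R)
    have 2: "(observe w (C i), \<mu> i) \<in> ex_rules M" if "fst (A i) = Exist"
      using exist(1)[rule_format, OF assms(4) that] unfolding view_trigger .
    from exist_decision_inv[OF assms(1) s 1 2] show ?thesis unfolding R fst_conv snd_conv .
  qed
qed

lemma family_step_inv:
  assumes "patm_wf M" "family_inv M N w X" "family_step M N w X Y"
  shows "family_inv M N w Y"
proof -
  obtain A C D E R E' where X: "X = (A, C, D, E)"
    and d: "decide M N A (\<lambda>i. view w (C i)) (\<lambda>i. priv_observe (D i)) E R E'"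
    and Y: "Y = (\<lambda>i. fst (R i), \<lambda>i. update w (fst (snd (R i))) (C i),
       \<lambda>i. priv_update (snd (snd (R i))) (D i), E')"
    using assms(3) by (auto simp: family_step_def)
  have "E' \<subseteq> E" using d by (auto simp: decide_def indist_def)
  then have 1: "E' \<subseteq> {..<N} \<times> {..<N}" using assms(2) unfolding X family_inv.simps by blast
  have "\<forall>i<N. slot_inv M w (fst (R i)) (update w (fst (snd (R i))) (C i)) (priv_update (snd (snd (R i))) (D i))"
    by (intro allI impI decide_inv[OF assms(1) assms(2)[unfolded X] d, THEN conjunct1])
  from this 1 show ?thesis
    unfolding Y family_inv.simps by (rule conjI)
qed

section \<open>Strategies versus runs of the family\<close>

declare observe.simps [simp del] update.simps [simp del]
  priv_observe.simps [simp del] priv_update.simps [simp del]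

text \<open>
  Winning the single play in which the universal moves are dictated by \<open>u\<close>, within \<open>n\<close> moves.
\<close>

primrec won :: "'a patm \<Rightarrow> 'a list \<Rightarrow> strategy \<Rightarrow> nat \<Rightarrow> 'a rule list \<Rightarrow> mem list \<Rightarrow>
    mode \<Rightarrow> mem \<Rightarrow> priv_mem \<Rightarrow> bool" where
  "won M w \<sigma> 0 u hs md c d \<longleftrightarrow> md = Accept"
| "won M w \<sigma> (Suc n) u hs md c d \<longleftrightarrow> md = Accept \<or>
     (md = Exist \<and> (observe w c, \<sigma> (hs @ [c])) \<in> ex_rules M \<and>
       won M w \<sigma> n u (hs @ [c]) (fst (\<sigma> (hs @ [c]))) (update w (snd (\<sigma> (hs @ [c]))) c) d) \<or>
     (md = Univ \<and> (\<forall>md' a b u'. u = ((observe w c, priv_observe d), (md', a, b)) # u' \<longrightarrow>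
       won M w \<sigma> n u' hs md' (update w a c) (priv_update b d)))"

lemma won_Exist:
  "won M w \<sigma> n u hs Exist c d \<Longrightarrow> (observe w c, \<sigma> (hs @ [c])) \<in> ex_rules M \<and>
    (\<exists>m. n = Suc m \<and> won M w \<sigma> m u (hs @ [c]) (fst (\<sigma> (hs @ [c]))) (update w (snd (\<sigma> (hs @ [c]))) c) d)"
  by (cases n) (simp_all)

lemma won_Univ:
  "won M w \<sigma> n u hs Univ c d \<Longrightarrow> \<exists>m. n = Suc m \<and>
    (\<forall>md' a b u'. u = ((observe w c, priv_observe d), (md', a, b)) # u' \<longrightarrow>
       won M w \<sigma> m u' hs md' (update w a c) (priv_update b d))"
  by (cases n) (simp_all)

text \<open>A derivation of \<open>wins\<close> is a well-founded tree; the list selects one branch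
  of it, and \<open>n\<close> is the length of that branch.\<close>

lemma wins_imp_won:
  assumes "wins M w \<sigma> hs x" and "set u \<subseteq> un_rules M"
  shows "\<exists>n. won M w \<sigma> n u hs (fst x) (fst (snd x)) (snd (snd x))"
  using assms
proof (induction arbitrary: u)
  case (wins_accept hs c d)
  have "won M w \<sigma> 0 u hs Accept c d" by simp
  then show ?case unfolding fst_conv snd_conv by blast
next
  case (wins_exist hs c md a d)
  from wins_exist.IH[OF wins_exist.prems] obtain n where
    "won M w \<sigma> n u (hs @ [c]) md (update w a c) d" by auto
  then have "won M w \<sigma> (Suc n) u hs Exist c d"
    using wins_exist.hyps by simp
  then show ?case unfolding fst_conv snd_conv by blast
next
  case (wins_univ c d hs)
  show ?case
  proof (cases "\<exists>md' a b u'. u = ((observe w c, priv_observe d), (md', a, b)) # u'")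
    case True
    then obtain md' a b u' where u: "u = ((observe w c, priv_observe d), (md', a, b)) # u'" by blast
    then have r: "((observe w c, priv_observe d), (md', a, b)) \<in> un_rules M" "set u' \<subseteq> un_rules M"
      using wins_univ.prems by auto
    from wins_univ.IH[OF r] obtain n where
      "won M w \<sigma> n u' hs md' (update w a c) (priv_update b d)" by auto
    then have "won M w \<sigma> (Suc n) u hs Univ c d"
      by (auto simp: u)
    then show ?thesis unfolding fst_conv snd_conv by blast
  next
    case False
    then have "won M w \<sigma> (Suc 0) u hs Univ c d"
      by simp
    then show ?thesis unfolding fst_conv snd_conv by blast
  qed
qed

text \<open>The outer induction is on the number \<open>k\<close> of universal moves still possible,
  the inner one on the length of the play up to the next universal turn. Each list may come with its
  own \<open>n\<close>; no common bound is needed.\<close>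

lemma won_imp_wins:
  assumes bound: "\<And>k x. patm_reach M w k x \<Longrightarrow> k \<le> K"
    and "\<And>u. set u \<subseteq> un_rules M \<Longrightarrow> length u \<le> k \<Longrightarrow> \<exists>n. won M w \<sigma> n u hs md c d"
    and "patm_reach M w j (md, c, d)" and "j + k = K"
  shows "wins M w \<sigma> hs (md, c, d)"
  using assms(2-)
proof (induction k arbitrary: hs md c d j rule: less_induct)
  case (less k)
  \<comment> \<open>Up to the next universal turn the play is independent of the list, so the empty
    list supplies the measure of the inner induction.\<close>
  have "\<exists>n. won M w \<sigma> n [] hs md c d" using less.prems(1)[of "[]"] by simp
  then obtain n where "won M w \<sigma> n [] hs md c d" ..
  then show ?case using less.prems
  proof (induction n arbitrary: hs md c d)
    case 0
    then show ?case by (auto intro: wins_accept)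
  next
    case (Suc n)
    show ?case
    proof (cases md)
      case Accept
      then show ?thesis by (auto intro: wins_accept)
    next
      case Reject
      then show ?thesis using Suc.prems(1) by simp
    next
      case Exist
      obtain md' a where mv: "\<sigma> (hs @ [c]) = (md', a)" by (rule prod.exhaust)
      have r: "(observe w c, (md', a)) \<in> ex_rules M" and n: "won M w \<sigma> n [] (hs @ [c]) md' (update w a c) d"
        using Suc.prems(1) Exist mv by auto
      have "\<exists>n. won M w \<sigma> n u (hs @ [c]) md' (update w a c) d" if "set u \<subseteq> un_rules M" "length u \<le> k" for u
        using won_Exist Suc.prems(2)[OF that] Exist mv by fastforce
      then have "wins M w \<sigma> (hs @ [c]) (md', update w a c, d)"
        using reach_exist[of M w j c d md' a] Suc.prems(3,4) r Exist by (intro Suc.IH[OF n]) auto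
      from wins_exist[of \<sigma> hs c md' a w M d, OF mv r this] show ?thesis unfolding Exist .
    next
      case Univ
      have "wins M w \<sigma> hs (md', update w a c, priv_update b d)"
        if r: "((observe w c, priv_observe d), (md', a, b)) \<in> un_rules M" for md' a b
      proof -
        have re: "patm_reach M w (Suc j) (md', update w a c, priv_update b d)"
          using reach_univ[OF _ r] Suc.prems(3) Univ by simp
        \<comment> \<open>With \<open>k = 0\<close> this universal move would be one too many for
          \<open>K\<close>.\<close>
        then have "0 < k" using bound[OF re] Suc.prems(4) by simp
        then obtain k' where k: "k = Suc k'" by (cases k) auto
        have "\<exists>n. won M w \<sigma> n u hs md' (update w a c) (priv_update b d)"
          if u: "set u \<subseteq> un_rules M" "length u \<le> k'" for u
        proof -
          have "\<exists>n. won M w \<sigma> n (((observe w c, priv_observe d), (md', a, b)) # u) hs Univ c d"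
            using Suc.prems(2)[of "((observe w c, priv_observe d), (md', a, b)) # u"] u r k Univ by auto
          then show ?thesis using won_Univ by blast
        qed
        then show ?thesis using less.IH[of k'] re k Suc.prems(4) by auto
      qed
      then show ?thesis unfolding Univ by (rule wins_univ)
    qed
  qed
qed

text \<open>This allows a strategy to be redefined on histories that already lie in the
  past.\<close>

lemma won_cong:
  assumes "\<And>h. length hs < length h \<Longrightarrow> \<sigma> h = \<sigma>' h"
  shows "won M w \<sigma> n u hs md c d = won M w \<sigma>' n u hs md c d"
  using assms
proof (induction n arbitrary: u hs md c d)
  case (Suc n)
  have "\<sigma> (hs @ [c]) = \<sigma>' (hs @ [c])" using Suc.prems by simp
  moreover have "won M w \<sigma> n u (hs @ [c]) md' c' d' = won M w \<sigma>' n u (hs @ [c]) md' c' d'" for u md' c' d'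
    using Suc.prems by (intro Suc.IH) auto
  moreover have "won M w \<sigma> n u hs md' c' d' = won M w \<sigma>' n u hs md' c' d'" for u md' c' d'
    using Suc.prems by (intro Suc.IH) auto
  ultimately show ?case by simp
qed simp

section \<open>Hidden histories and their representation by the relation and the logs\<close>

lemma univ_decision_cases:
  assumes "mem_ok P w c" "univ_decision x (view w c) (priv_observe d) = (x', a, b)"
  obtains (keep) "fst x \<noteq> Univ" "x' = x" "update w a c = c" "priv_update b d = d"
  | (dead) u lg where "x = (Univ, u, lg)" "x' = (Accept, u, lg)" "update w a c = c" "priv_update b d = d"
      "\<And>md' a' b' u'. u \<noteq> ((observe w c, priv_observe d), (md', a', b')) # u'"
  | (move) md' u' lg where "x = (Univ, ((observe w c, priv_observe d), (md', a, b)) # u', lg)"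
      "x' = (md', u', lg @ [(view w c, a)])"
proof -
  obtain md u lg where x: "x = (md, u, lg)" by (metis prod.exhaust)
  note idle = update_idle[OF assms(1)] priv_update_idle[of d]
  show ?thesis
  proof (cases "md = Univ")
    case False
    then show ?thesis using assms(2) idle
      by (intro keep) (auto simp: x view_trigger split: mode.splits)
  next
    case Univ: True
    show ?thesis
    proof (cases "\<exists>md' a' b' u'. u = ((observe w c, priv_observe d), (md', a', b')) # u'")
      case True
      then show ?thesis using assms(2) Univ move by (auto simp: x view_trigger)
    next
      case False
      then have "x' = (Accept, u, lg)" "a = idle_action (observe w c)" "b = idle_priv (priv_observe d)"
        using assms(2) Univ by (auto simp: x view_trigger split: list.splits prod.splits if_splits)
      then show ?thesis using idle False Univ dead[of u lg] x by auto
    qed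
  qed
qed

lemma exist_decision_cases:
  assumes "mem_ok P w c" "exist_decision \<mu> x (view w c) (priv_observe d) = (x', a, b)"
  obtains (keep) "fst x \<noteq> Exist" "x' = x" "update w a c = c" "priv_update b d = d"
  | (move) u lg where "x = (Exist, u, lg)" "x' = (fst \<mu>, u, [])" "a = snd \<mu>" "priv_update b d = d"
proof -
  obtain md u lg where x: "x = (md, u, lg)" by (metis prod.exhaust)
  obtain md' a' where mu: "\<mu> = (md', a')" by (rule prod.exhaust)
  show ?thesis
  proof (cases "md = Exist")
    case True
    show ?thesis
      by (rule move[of u lg]) (use True assms(2) priv_update_idle[of d] in \<open>auto simp: x mu\<close>)
  next
    case False
    show ?thesis
      by (rule keep) (use False assms(2) update_idle[OF assms(1)] priv_update_idle[of d] in \<open>auto simp: x mu view_trigger\<close>)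
  qed
qed

text \<open>
  The histories \<open>H\<close> and the memories \<open>B\<close> after the last existential move are not stored by the
  machine; \<open>E\<close> and the logs stand in for them.
\<close>

definition hist_inv :: "nat \<Rightarrow> nat \<Rightarrow> 'a list \<Rightarrow> (nat \<Rightarrow> 'a aux) \<Rightarrow> (nat \<Rightarrow> mem) \<Rightarrow> (nat \<times> nat) set \<Rightarrow>
    (nat \<Rightarrow> mem list) \<Rightarrow> (nat \<Rightarrow> mem) \<Rightarrow> nat \<Rightarrow> bool" where
  "hist_inv P N w A C E H B r \<longleftrightarrow>
     (\<forall>i<N. length (H i) = r \<and> mem_ok P w (B i) \<and> log_ok w (snd (snd (A i))) (B i) \<and>
        log_run w (snd (snd (A i))) (B i) = C i) \<and>
     (\<forall>(i, j)\<in>E. H i = H j \<and> B i = B j) \<and>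
     (\<forall>i<N. \<forall>j<N. fst (A i) \<noteq> Accept \<longrightarrow> fst (A j) \<noteq> Accept \<longrightarrow> H i = H j \<longrightarrow> (i, j) \<in> E)"

text \<open>Universal moves are recorded in the logs only, so \<open>H\<close>, \<open>B\<close> and
  \<open>E\<close> stay as they are.\<close>

lemma hist_inv_univ:
  assumes wf: "patm_wf M" and fam: "family_inv M N w (A, C, D, E)"
    and hist: "hist_inv (pub_tapes M) N w A C E H B r"
    and R: "\<forall>i<N. R i = univ_decision (A i) (view w (C i)) (priv_observe (D i))"
  shows "hist_inv (pub_tapes M) N w (\<lambda>i. fst (R i)) (\<lambda>i. update w (fst (snd (R i))) (C i)) E H B r"
proof -
  have slot: "log_ok w (snd (snd (fst (R i)))) (B i) \<and>
      log_run w (snd (snd (fst (R i)))) (B i) = update w (fst (snd (R i))) (C i) \<and>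
      (fst (fst (R i)) \<noteq> Accept \<longrightarrow> fst (A i) \<noteq> Accept)" if i: "i < N" for i
  proof -
    obtain x' a b where Ri: "R i = (x', a, b)" by (metis prod.exhaust)
    have d: "univ_decision (A i) (view w (C i)) (priv_observe (D i)) = (x', a, b)"
      using R i Ri by metis
    have s: "slot_inv M w (A i) (C i) (D i)" using fam i unfolding family_inv.simps by blast
    have old: "log_ok w (snd (snd (A i))) (B i)" "log_run w (snd (snd (A i))) (B i) = C i"
      using hist i unfolding hist_inv_def by blast+
    have len: "length (snd (snd a)) = length (snd (snd (C i)))"
      using univ_decision_inv[OF wf s d] slot_inv_shape[OF wf s] by (simp add: mem_ok_def)
    from slot_inv_shape(1)[OF wf s] d show ?thesis
    proof (cases rule: univ_decision_cases)
      case keep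
      then show ?thesis using old Ri by simp
    next
      case dead
      then show ?thesis using old Ri by simp
    next
      case move
      then show ?thesis using old Ri len by (simp add: log_ok_snoc log_run_snoc)
    qed
  qed
  have h1: "\<forall>i<N. length (H i) = r \<and> mem_ok (pub_tapes M) w (B i)"
    and h2: "\<forall>(i, j)\<in>E. H i = H j \<and> B i = B j"
    and h3: "\<forall>i<N. \<forall>j<N. fst (A i) \<noteq> Accept \<longrightarrow> fst (A j) \<noteq> Accept \<longrightarrow> H i = H j \<longrightarrow> (i, j) \<in> E"
    using hist unfolding hist_inv_def by blast+
  show ?thesis
    unfolding hist_inv_def using h1 h2 h3 slot by blast
qed

text \<open>What the machine computes from finite data is exactly equality of the extended
  histories: for pairs in \<open>E\<close> the starting points \<open>B\<close> coincide, so the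
  logs decide whether the current memories do; live slots outside \<open>E\<close> had different
  histories before.\<close>

lemma indist_iff:
  assumes fam: "family_inv M N w (A, C, D, E)"
    and hist: "hist_inv (pub_tapes M) N w A C E H B r"
  shows "(i, j) \<in> indist (pub_tapes M) A E \<longleftrightarrow> i < N \<and> j < N \<and> fst (A i) = Exist \<and> fst (A j) = Exist \<and>
    H i @ [C i] = H j @ [C j]"
proof -
  have run: "mem_ok (pub_tapes M) w (B i)" "log_ok w (snd (snd (A i))) (B i)" "log_run w (snd (snd (A i))) (B i) = C i"
    if "i < N" for i
    using hist that unfolding hist_inv_def by blast+
  have same: "same_result (pub_tapes M) (snd (snd (A i))) (snd (snd (A j))) \<longleftrightarrow> C i = C j"
    if "i < N" "j < N" "B i = B j"
    using same_result_iff[OF run(1)[OF that(1)] run(2)[OF that(1)], of "snd (snd (A j))"]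
      run(2,3)[OF that(2)] run(3)[OF that(1)] that(3) by simp
  have E: "i < N \<and> j < N \<and> H i = H j \<and> B i = B j" if "(i, j) \<in> E"
    using hist fam that unfolding hist_inv_def by auto
  show ?thesis
  proof
    assume "(i, j) \<in> indist (pub_tapes M) A E"
    then show "i < N \<and> j < N \<and> fst (A i) = Exist \<and> fst (A j) = Exist \<and> H i @ [C i] = H j @ [C j]"
      using E same unfolding indist_def by auto
  next
    assume r: "i < N \<and> j < N \<and> fst (A i) = Exist \<and> fst (A j) = Exist \<and> H i @ [C i] = H j @ [C j]"
    then have "(i, j) \<in> E" using hist unfolding hist_inv_def by auto
    then show "(i, j) \<in> indist (pub_tapes M) A E"
      using E same r unfolding indist_def by auto
  qed
qed

lemma hist_inv_exist:
  assumes wf: "patm_wf M" and fam: "family_inv M N w (A, C, D, E)"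
    and hist: "hist_inv (pub_tapes M) N w A C E H B r"
    and modes: "\<forall>i<N. fst (A i) \<in> {Exist, Accept}"
    and E': "E' = indist (pub_tapes M) A E"
    and \<mu>: "\<forall>i<N. fst (A i) = Exist \<longrightarrow> (view_trigger (view w (C i)), \<mu> i) \<in> ex_rules M"
    and cons: "\<forall>(i, j)\<in>E'. \<mu> i = \<mu> j"
    and R: "\<forall>i<N. R i = exist_decision (\<mu> i) (A i) (view w (C i)) (priv_observe (D i))"
  shows "\<exists>B'. hist_inv (pub_tapes M) N w (\<lambda>i. fst (R i)) (\<lambda>i. update w (fst (snd (R i))) (C i)) E'
    (\<lambda>i. H i @ [C i]) B' (Suc r)"
proof -
  \<comment> \<open>A slot that moves starts a new log at its new memory. A slot already won keeps
    its log and hence its old starting point, but its history is extended as well, so that all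
    lengths stay equal.\<close>
  define B' where "B' i = (if fst (A i) = Exist then update w (snd (\<mu> i)) (C i) else B i)" for i
  have slot: "mem_ok (pub_tapes M) w (B' i) \<and> log_ok w (snd (snd (fst (R i)))) (B' i) \<and>
      log_run w (snd (snd (fst (R i)))) (B' i) = update w (fst (snd (R i))) (C i) \<and>
      (fst (fst (R i)) \<noteq> Accept \<longrightarrow> fst (A i) = Exist)" if i: "i < N" for i
  proof -
    obtain x' a b where Ri: "R i = (x', a, b)" by (metis prod.exhaust)
    have d: "exist_decision (\<mu> i) (A i) (view w (C i)) (priv_observe (D i)) = (x', a, b)"
      using R i Ri by metis
    have s: "slot_inv M w (A i) (C i) (D i)" using fam i unfolding family_inv.simps by blast
    have old: "mem_ok (pub_tapes M) w (B i)" "log_ok w (snd (snd (A i))) (B i)" "log_run w (snd (snd (A i))) (B i) = C i"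
      using hist i unfolding hist_inv_def by blast+
    have rule: "(observe w (C i), \<mu> i) \<in> ex_rules M" if "fst (A i) = Exist"
      using \<mu> i that by (simp add: view_trigger)
    have len: "length (snd (snd a)) = pub_tapes M"
      using exist_decision_inv[OF wf s d rule] by blast
    from slot_inv_shape(1)[OF wf s] d show ?thesis
    proof (cases rule: exist_decision_cases)
      case keep
      then show ?thesis using old Ri modes i by (auto simp: B'_def)
    next
      case move
      then show ?thesis using Ri len mem_ok_update[OF slot_inv_shape(1)[OF wf s], of a]
        by (simp add: B'_def)
    qed
  qed
  have 1: "\<forall>i<N. length (H i @ [C i]) = Suc r" using hist unfolding hist_inv_def by simp
  have 2: "\<forall>(i, j)\<in>E'. H i @ [C i] = H j @ [C j] \<and> B' i = B' j"
    using cons indist_iff[OF fam hist] unfolding E' B'_def by fastforce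
  have 3: "\<forall>i<N. \<forall>j<N. fst (fst (R i)) \<noteq> Accept \<longrightarrow> fst (fst (R j)) \<noteq> Accept \<longrightarrow>
      H i @ [C i] = H j @ [C j] \<longrightarrow> (i, j) \<in> E'"
    using indist_iff[OF fam hist] slot unfolding E' by blast
  show ?thesis
    unfolding hist_inv_def using 1 2 3 slot by blast
qed

section \<open>Accepting runs of the family against winning strategies\<close>

definition all_accept :: "nat \<Rightarrow> 'a family \<Rightarrow> bool" where
  "all_accept N X \<longleftrightarrow> (\<forall>i<N. fst (fst X i) = Accept)"

lemma family_stepI:
  "decide M N A (\<lambda>i. view w (C i)) (\<lambda>i. priv_observe (D i)) E R E' \<Longrightarrow>
   family_step M N w (A, C, D, E) (\<lambda>i. fst (R i), \<lambda>i. update w (fst (snd (R i))) (C i),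
       \<lambda>i. priv_update (snd (snd (R i))) (D i), E')"
  unfolding family_step_def by blast

text \<open>The strategy is built backwards along the run. Universal steps leave it as it is; an
  existential step prescribes its values on the histories of one length, consistently because equal
  histories received equal moves.\<close>

lemma run_imp_won:
  assumes wf: "patm_wf M" and "(family_step M N w)\<^sup>*\<^sup>* X Y" and "all_accept N Y"
    and "X = (A, C, D, E)" "family_inv M N w X" "hist_inv (pub_tapes M) N w A C E H B r"
  shows "\<exists>\<sigma>. \<forall>i<N. \<exists>n. won M w \<sigma> n (fst (snd (A i))) (H i) (fst (A i)) (C i) (D i)"
  using assms(2-)
proof (induction arbitrary: A C D E H B r rule: converse_rtranclp_induct)
  case base
  then have "won M w \<sigma> 0 (fst (snd (A i))) (H i) (fst (A i)) (C i) (D i)" if "i < N" for i \<sigma>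
    using that by (simp add: all_accept_def)
  then show ?case by blast
next
  case (step X X')
  note hist = step.prems(4)
  have fam: "family_inv M N w (A, C, D, E)" using step.prems(2,3) by simp
  have fam': "family_inv M N w X'" using family_step_inv[OF wf step.prems(3) step.hyps(1)] .
  obtain R E' where dec: "decide M N A (\<lambda>i. view w (C i)) (\<lambda>i. priv_observe (D i)) E R E'"
    and X': "X' = (\<lambda>i. fst (R i), \<lambda>i. update w (fst (snd (R i))) (C i),
       \<lambda>i. priv_update (snd (snd (R i))) (D i), E')"
    using step.hyps(1) step.prems(2) by (auto simp: family_step_def)
  have shape: "mem_ok (pub_tapes M) w (C i)" if "i < N" for i
    using fam that slot_inv_shape(1)[OF wf] unfolding family_inv.simps by blast
  consider (univ) "E' = E" "\<forall>i<N. R i = univ_decision (A i) (view w (C i)) (priv_observe (D i))"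
    | (exist) \<mu> where "\<forall>i<N. fst (A i) \<in> {Exist, Accept}" "E' = indist (pub_tapes M) A E"
      "\<forall>i<N. fst (A i) = Exist \<longrightarrow> (view_trigger (view w (C i)), \<mu> i) \<in> ex_rules M"
      "\<forall>(i, j)\<in>E'. \<mu> i = \<mu> j"
      "\<forall>i<N. R i = exist_decision (\<mu> i) (A i) (view w (C i)) (priv_observe (D i))"
    using dec unfolding decide_def by (elim disjE conjE exE)
  then show ?case
  proof cases
    case univ
    from hist_inv_univ[OF wf fam hist univ(2)]
    have "hist_inv (pub_tapes M) N w (\<lambda>i. fst (R i)) (\<lambda>i. update w (fst (snd (R i))) (C i)) E' H B r"
      unfolding univ(1) .
    from step.IH[OF step.prems(1) X' fam' this] obtain \<sigma> where
      \<sigma>: "\<And>i. i < N \<Longrightarrow> \<exists>n. won M w \<sigma> n (fst (snd (fst (R i)))) (H i) (fst (fst (R i)))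
         (update w (fst (snd (R i))) (C i)) (priv_update (snd (snd (R i))) (D i))" by blast
    have "\<exists>n. won M w \<sigma> n (fst (snd (A i))) (H i) (fst (A i)) (C i) (D i)" if i: "i < N" for i
    proof -
      obtain x' a b where Ri: "R i = (x', a, b)" by (metis prod.exhaust)
      have d: "univ_decision (A i) (view w (C i)) (priv_observe (D i)) = (x', a, b)"
        using univ(2) i Ri by metis
      obtain n where n: "won M w \<sigma> n (fst (snd x')) (H i) (fst x') (update w a (C i)) (priv_update b (D i))"
        using \<sigma>[OF i] Ri by auto
      from shape[OF i] d show ?thesis
      proof (cases rule: univ_decision_cases)
        case keep
        then show ?thesis using n by auto
      next
        case (dead u lg)
        then have "won M w \<sigma> (Suc 0) (fst (snd (A i))) (H i) (fst (A i)) (C i) (D i)" by simp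
        then show ?thesis ..
      next
        case (move md' u' lg)
        then have "won M w \<sigma> (Suc n) (fst (snd (A i))) (H i) (fst (A i)) (C i) (D i)"
          using n by auto
        then show ?thesis ..
      qed
    qed
    then show ?thesis by blast
  next
    case exist
    obtain B' where hist': "hist_inv (pub_tapes M) N w (\<lambda>i. fst (R i)) (\<lambda>i. update w (fst (snd (R i))) (C i)) E'
        (\<lambda>i. H i @ [C i]) B' (Suc r)"
      using hist_inv_exist[OF wf fam hist exist] by blast
    from step.IH[OF step.prems(1) X' fam' hist'] obtain \<sigma>' where
      \<sigma>': "\<And>i. i < N \<Longrightarrow> \<exists>n. won M w \<sigma>' n (fst (snd (fst (R i)))) (H i @ [C i]) (fst (fst (R i)))
         (update w (fst (snd (R i))) (C i)) (priv_update (snd (snd (R i))) (D i))" by blast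
    \<comment> \<open>Any slot with history \<open>h\<close> will do: the choice does not affect the
      guessed move.\<close>
    define pick where "pick h = (SOME i. i < N \<and> fst (A i) = Exist \<and> H i @ [C i] = h)" for h
    define \<sigma> where "\<sigma> h = (if length h = Suc r then \<mu> (pick h) else \<sigma>' h)" for h
    have len: "length (H i) = r" if "i < N" for i using hist that unfolding hist_inv_def by blast
    have \<sigma>_now: "\<sigma> (H i @ [C i]) = \<mu> i" if i: "i < N" "fst (A i) = Exist" for i
    proof -
      have "pick (H i @ [C i]) < N \<and> fst (A (pick (H i @ [C i]))) = Exist \<and>
          H (pick (H i @ [C i])) @ [C (pick (H i @ [C i]))] = H i @ [C i]"
        unfolding pick_def by (rule someI[of _ i]) (use i in blast)
      then have "(pick (H i @ [C i]), i) \<in> E'"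
        using indist_iff[OF fam hist] i unfolding exist(2) by blast
      then have "\<mu> (pick (H i @ [C i])) = \<mu> i" using exist(4) by blast
      then show ?thesis using len[OF i(1)] by (simp add: \<sigma>_def)
    qed
    have "\<exists>n. won M w \<sigma> n (fst (snd (A i))) (H i) (fst (A i)) (C i) (D i)" if i: "i < N" for i
    proof -
      obtain x' a b where Ri: "R i = (x', a, b)" by (metis prod.exhaust)
      have d: "exist_decision (\<mu> i) (A i) (view w (C i)) (priv_observe (D i)) = (x', a, b)"
        using exist(5) i Ri by metis
      obtain n where n: "won M w \<sigma>' n (fst (snd x')) (H i @ [C i]) (fst x') (update w a (C i)) (priv_update b (D i))"
        using \<sigma>'[OF i] Ri by auto
      \<comment> \<open>From here on only histories longer than \<open>Suc r\<close> are consulted,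
        where \<open>\<sigma>\<close> and \<open>\<sigma>'\<close> agree.\<close>
      then have n': "won M w \<sigma> n (fst (snd x')) (H i @ [C i]) (fst x') (update w a (C i)) (priv_update b (D i))"
        by (subst won_cong[where \<sigma>' = \<sigma>']) (auto simp: \<sigma>_def len[OF i])
      from shape[OF i] d show ?thesis
      proof (cases rule: exist_decision_cases)
        case keep
        then have "won M w \<sigma> 0 (fst (snd (A i))) (H i) (fst (A i)) (C i) (D i)"
          using exist(1) i by auto
        then show ?thesis ..
      next
        case (move u lg)
        then have "(observe w (C i), \<mu> i) \<in> ex_rules M" "\<sigma> (H i @ [C i]) = \<mu> i"
          using exist(3) i \<sigma>_now[OF i] by (auto simp: view_trigger)
        then have "won M w \<sigma> (Suc n) (fst (snd (A i))) (H i) (fst (A i)) (C i) (D i)"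
          using n' move by simp
        then show ?thesis ..
      qed
    qed
    then show ?thesis by blast
  qed
qed

lemma won_Accept: "won M w \<sigma> n u hs Accept c d"
  by (cases n) auto

text \<open>Guessing the moves of a fixed strategy is automatically consistent, since they depend on
  the histories only. The sum of the remaining play lengths drops because in each step some slot
  makes a move or is declared won.\<close>

lemma won_imp_run:
  assumes wf: "patm_wf M"
    and "family_inv M N w (A, C, D, E)" "hist_inv (pub_tapes M) N w A C E H B r"
    and "\<And>i. i < N \<Longrightarrow> won M w \<sigma> (f i) (fst (snd (A i))) (H i) (fst (A i)) (C i) (D i)"
  shows "\<exists>Y. (family_step M N w)\<^sup>*\<^sup>* (A, C, D, E) Y \<and> all_accept N Y"
  using assms(2-)
proof (induction "\<Sum>i<N. f i" arbitrary: A C D E H B r f rule: less_induct)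
  case less
  note fam = less.prems(1) and hist = less.prems(2)
  have shape: "mem_ok (pub_tapes M) w (C i)" if "i < N" for i
    using fam that slot_inv_shape(1)[OF wf] unfolding family_inv.simps by blast
  have next_step: ?case
    if dec: "decide M N A (\<lambda>i. view w (C i)) (\<lambda>i. priv_observe (D i)) E R E'"
      and hist': "hist_inv (pub_tapes M) N w (\<lambda>i. fst (R i)) (\<lambda>i. update w (fst (snd (R i))) (C i)) E' H' B' r'"
      and g: "\<And>i. i < N \<Longrightarrow> won M w \<sigma> (g i) (fst (snd (fst (R i)))) (H' i) (fst (fst (R i)))
         (update w (fst (snd (R i))) (C i)) (priv_update (snd (snd (R i))) (D i))"
      and gf: "\<And>i. i < N \<Longrightarrow> g i \<le> f i" "\<exists>i<N. g i < f i" for R E' H' B' r' g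
  proof -
    have "sum g {..<N} < sum f {..<N}"
      using gf by (intro sum_strict_mono_ex1) auto
    moreover note st = family_stepI[OF dec]
    ultimately obtain Y where "(family_step M N w)\<^sup>*\<^sup>* (\<lambda>i. fst (R i), \<lambda>i. update w (fst (snd (R i))) (C i),
       \<lambda>i. priv_update (snd (snd (R i))) (D i), E') Y" "all_accept N Y"
      using less.hyps[OF _ family_step_inv[OF wf fam st] hist' g] by blast
    then show ?thesis using converse_rtranclp_into_rtranclp[of "family_step M N w", OF st] by blast
  qed
  show ?case
  proof (cases "\<exists>i<N. fst (A i) = Univ")
    case True
    define R where "R i = univ_decision (A i) (view w (C i)) (priv_observe (D i))" for i
    have slot: "won M w \<sigma> (if fst (A i) = Univ then f i - 1 else f i) (fst (snd (fst (R i)))) (H i) (fst (fst (R i)))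
         (update w (fst (snd (R i))) (C i)) (priv_update (snd (snd (R i))) (D i)) \<and>
       (fst (A i) = Univ \<longrightarrow> 0 < f i)" if i: "i < N" for i
    proof -
      obtain x' a b where Ri: "R i = (x', a, b)" by (metis prod.exhaust)
      then have d: "univ_decision (A i) (view w (C i)) (priv_observe (D i)) = (x', a, b)"
        by (simp add: R_def)
      note w = less.prems(3)[OF i]
      from shape[OF i] d show ?thesis
      proof (cases rule: univ_decision_cases)
        case keep
        then show ?thesis using w Ri by simp
      next
        case (dead u lg)
        then have "won M w \<sigma> (f i) u (H i) Univ (C i) (D i)" using w by simp
        then obtain m where "f i = Suc m" using won_Univ by blast
        then show ?thesis using dead Ri by (simp add: won_Accept)
      next
        case (move md' u' lg)
        then have "won M w \<sigma> (f i) (((observe w (C i), priv_observe (D i)), (md', a, b)) # u') (H i) Univ (C i) (D i)"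
          using w by simp
        then obtain m where "f i = Suc m" "won M w \<sigma> m u' (H i) md' (update w a (C i)) (priv_update b (D i))"
          using won_Univ by blast
        then show ?thesis using move Ri by simp
      qed
    qed
    show ?thesis
    proof (rule next_step)
      show "decide M N A (\<lambda>i. view w (C i)) (\<lambda>i. priv_observe (D i)) E R E"
        using True by (simp add: decide_def R_def)
      show "hist_inv (pub_tapes M) N w (\<lambda>i. fst (R i)) (\<lambda>i. update w (fst (snd (R i))) (C i)) E H B r"
        by (rule hist_inv_univ[OF wf fam hist]) (simp add: R_def)
      show "won M w \<sigma> ((\<lambda>i. if fst (A i) = Univ then f i - 1 else f i) i) (fst (snd (fst (R i)))) (H i) (fst (fst (R i)))
         (update w (fst (snd (R i))) (C i)) (priv_update (snd (snd (R i))) (D i))" if "i < N" for i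
        using slot[OF that] by simp
      show "(if fst (A i) = Univ then f i - 1 else f i) \<le> f i" for i by simp
      show "\<exists>i<N. (if fst (A i) = Univ then f i - 1 else f i) < f i"
        using True slot by auto
    qed
  next
    case nouniv: False
    show ?thesis
    proof (cases "all_accept N (A, C, D, E)")
      case True
      then show ?thesis by blast
    next
      case False
      have modes: "\<forall>i<N. fst (A i) \<in> {Exist, Accept}"
      proof (intro allI impI)
        fix i assume i: "i < N"
        have "fst (A i) \<noteq> Reject" using less.prems(3)[OF i] by (cases "f i") auto
        then show "fst (A i) \<in> {Exist, Accept}" using nouniv i by (cases "fst (A i)") auto
      qed
      then obtain i0 where i0: "i0 < N" "fst (A i0) = Exist" using False by (auto simp: all_accept_def)
      define \<mu> where "\<mu> i = \<sigma> (H i @ [C i])" for i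
      define R where "R i = exist_decision (\<mu> i) (A i) (view w (C i)) (priv_observe (D i))" for i
      define E' where "E' = indist (pub_tapes M) A E"
      have slot: "won M w \<sigma> (if fst (A i) = Exist then f i - 1 else f i) (fst (snd (fst (R i)))) (H i @ [C i]) (fst (fst (R i)))
           (update w (fst (snd (R i))) (C i)) (priv_update (snd (snd (R i))) (D i)) \<and>
         (fst (A i) = Exist \<longrightarrow> 0 < f i \<and> (view_trigger (view w (C i)), \<mu> i) \<in> ex_rules M)" if i: "i < N" for i
      proof -
        obtain x' a b where Ri: "R i = (x', a, b)" by (metis prod.exhaust)
        then have d: "exist_decision (\<mu> i) (A i) (view w (C i)) (priv_observe (D i)) = (x', a, b)"
          by (simp add: R_def)
        note w = less.prems(3)[OF i]
        from shape[OF i] d show ?thesis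
        proof (cases rule: exist_decision_cases)
          case keep
          then show ?thesis using modes i Ri by (auto simp: won_Accept)
        next
          case (move u lg)
          then show ?thesis using Ri w won_Exist[of M w \<sigma> "f i" u "H i" "C i" "D i"]
            by (auto simp: \<mu>_def view_trigger)
        qed
      qed
      have rules: "\<forall>i<N. fst (A i) = Exist \<longrightarrow> (view_trigger (view w (C i)), \<mu> i) \<in> ex_rules M"
        using slot by blast
      have cons: "\<forall>(i, j)\<in>E'. \<mu> i = \<mu> j"
        using indist_iff[OF fam hist] by (auto simp: E'_def \<mu>_def)
      have R: "\<forall>i<N. R i = exist_decision (\<mu> i) (A i) (view w (C i)) (priv_observe (D i))"
        by (simp add: R_def)
      obtain B' where hist': "hist_inv (pub_tapes M) N w (\<lambda>i. fst (R i)) (\<lambda>i. update w (fst (snd (R i))) (C i)) E'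
          (\<lambda>i. H i @ [C i]) B' (Suc r)"
        using hist_inv_exist[OF wf fam hist modes E'_def rules cons R] by blast
      show ?thesis
      proof (rule next_step)
        show "decide M N A (\<lambda>i. view w (C i)) (\<lambda>i. priv_observe (D i)) E R E'"
          unfolding decide_def using modes E'_def rules cons R by blast
        show "won M w \<sigma> ((\<lambda>i. if fst (A i) = Exist then f i - 1 else f i) i) (fst (snd (fst (R i)))) (H i @ [C i]) (fst (fst (R i)))
           (update w (fst (snd (R i))) (C i)) (priv_update (snd (snd (R i))) (D i))" if "i < N" for i
          using slot[OF that] by simp
        show "(if fst (A i) = Exist then f i - 1 else f i) \<le> f i" for i by simp
        show "\<exists>i<N. (if fst (A i) = Exist then f i - 1 else f i) < f i"
          using i0 slot[OF i0(1)] by auto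
      qed (rule hist')
    qed
  qed
qed

section \<open>The family as a multi-head machine\<close>

text \<open>For each slot: the auxiliary data, the public and the private control state. Head
  \<open>i\<close> is the input head of slot \<open>i\<close>; the indices \<open>(i, Inl j)\<close>
  and \<open>(i, Inr j)\<close> are its public and private tapes.\<close>

type_synonym 'a family_state = "(nat \<Rightarrow> 'a aux \<times> nat \<times> nat) \<times> (nat \<times> nat) set"

definition no_slot :: "'a aux \<times> nat \<times> nat" where
  "no_slot = ((Accept, [], []), 0, 0)"

definition slot_view :: "'a patm \<Rightarrow> (nat \<Rightarrow> 'a aux \<times> nat \<times> nat) \<Rightarrow> (nat \<Rightarrow> 'a isym) \<Rightarrow>
    (nat \<times> (nat + nat)) obs \<Rightarrow> nat \<Rightarrow> 'a view" where
  "slot_view M Z xs ob i = (fst (snd (Z i)), xs i, map (\<lambda>j. ob (i, Inl j)) [0..<pub_tapes M])"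

definition slot_priv :: "'a patm \<Rightarrow> (nat \<Rightarrow> 'a aux \<times> nat \<times> nat) \<Rightarrow>
    (nat \<times> (nat + nat)) obs \<Rightarrow> nat \<Rightarrow> priv_trigger" where
  "slot_priv M Z ob i = (snd (snd (Z i)), map (\<lambda>j. snd (ob (i, Inr j))) [0..<priv_tapes M])"

definition spread :: "'a patm \<Rightarrow> nat \<Rightarrow> 'x \<Rightarrow> (nat \<Rightarrow> 'x list) \<Rightarrow> (nat \<Rightarrow> 'x list) \<Rightarrow> nat \<times> (nat + nat) \<Rightarrow> 'x" where
  "spread M N d f g = (\<lambda>(i, t). if i < N then
      (case t of Inl j \<Rightarrow> if j < pub_tapes M then f i ! j else d
       | Inr j \<Rightarrow> if j < priv_tapes M then g i ! j else d) else d)"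

definition family_machine :: "'a patm \<Rightarrow> nat \<Rightarrow> 'a family_state \<Rightarrow> (nat \<Rightarrow> 'a isym) \<Rightarrow> (nat \<times> (nat + nat)) obs \<Rightarrow>
    'a family_state \<times> (nat \<Rightarrow> move) \<times> (nat \<times> (nat + nat)) acts \<Rightarrow> bool" where
  "family_machine M N z xs ob y \<longleftrightarrow> (\<exists>Z E R E'. z = (Z, E) \<and>
     decide M N (\<lambda>i. fst (Z i)) (slot_view M Z xs ob) (slot_priv M Z ob) E R E' \<and>
     y = ((\<lambda>i. if i < N then (fst (R i), fst (fst (snd (R i))), fst (snd (snd (R i)))) else no_slot, E'),
       \<lambda>i. if i < N then fst (snd (fst (snd (R i)))) else Stay,
       spread M N (0, Stay) (\<lambda>i. snd (snd (fst (snd (R i))))) (\<lambda>i. snd (snd (snd (R i))))))"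

fun family_config :: "'a patm \<Rightarrow> nat \<Rightarrow> 'a family \<Rightarrow> 'a family_state \<times> (nat \<Rightarrow> nat) \<times> (nat \<times> (nat + nat)) tapes" where
  "family_config M N (A, C, D, E) = ((\<lambda>i. if i < N then (A i, fst (C i), fst (D i)) else no_slot, E),
     \<lambda>i. if i < N then fst (snd (C i)) else 0,
     spread M N blank_tape (\<lambda>i. snd (snd (C i))) (\<lambda>i. snd (D i)))"

lemma decide_cong:
  assumes "\<And>i. i < N \<Longrightarrow> A i = A' i \<and> V i = V' i \<and> W i = W' i" and "E \<subseteq> {..<N} \<times> {..<N}"
  shows "decide M N A V W E R E' \<longleftrightarrow> decide M N A' V' W' E R E'"
proof -
  have "indist (pub_tapes M) A E = indist (pub_tapes M) A' E"
    using assms by (auto simp: indist_def)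
  moreover have "(\<exists>i<N. fst (A i) = Univ) \<longleftrightarrow> (\<exists>i<N. fst (A' i) = Univ)"
    using assms(1) by (metis (no_types))
  ultimately show ?thesis
    using assms(1) by (simp add: decide_def)
qed

lemma update_fields:
  "fst (update w a c) = fst a"
  "fst (snd (update w a c)) = min (length w + 1) (shift (fst (snd a)) (fst (snd c)))"
  "snd (snd (update w a c)) = map2 write_move (snd (snd a)) (snd (snd c))"
  by (cases a; cases c; simp add: update.simps)+

lemma priv_update_fields:
  "fst (priv_update b d) = fst b"
  "snd (priv_update b d) = map2 write_move (snd b) (snd d)"
  by (cases b; cases d; simp add: priv_update.simps)+

lemma write_blank: "write_move (0, Stay) blank_tape = blank_tape"
  by (auto simp: blank_tape_def)

lemma family_config_step:
  assumes wf: "patm_wf M" and fam: "family_inv M N w X"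
  shows "multihead_step (family_machine M N) w (family_config M N X) Y \<longleftrightarrow> (\<exists>X'. family_step M N w X X' \<and> Y = family_config M N X')"
proof -
  obtain A C D E where X: "X = (A, C, D, E)" by (metis prod.exhaust)
  define Z where "Z = (\<lambda>i. if i < N then (A i, fst (C i), fst (D i)) else no_slot)"
  define p where "p = (\<lambda>i. if i < N then fst (snd (C i)) else 0)"
  define T where "T = spread M N blank_tape (\<lambda>i. snd (snd (C i))) (\<lambda>i. snd (D i))"
  have pr: "family_config M N X = ((Z, E), p, T)" by (simp add: X Z_def p_def T_def)
  have shape: "length (snd (snd (C i))) = pub_tapes M" "length (snd (D i)) = priv_tapes M" if "i < N" for i
    using slot_inv_shape[OF wf, of w "A i" "C i" "D i"] fam that unfolding X family_inv.simps
    by (auto simp: mem_ok_def)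
  have views: "fst (Z i) = A i \<and> slot_view M Z (\<lambda>j. input_at w (p j)) (look \<circ> T) i = view w (C i) \<and>
      slot_priv M Z (look \<circ> T) i = priv_observe (D i)" if i: "i < N" for i
  proof -
    have "map (\<lambda>j. look (T (i, Inl j))) [0..<pub_tapes M] = map look (snd (snd (C i)))"
      using shape[OF i] i by (intro nth_equalityI) (auto simp: T_def spread_def)
    moreover have "map (\<lambda>j. snd (look (T (i, Inr j)))) [0..<priv_tapes M] = map scan (snd (D i))"
      using shape[OF i] i by (intro nth_equalityI) (auto simp: T_def spread_def look_def)
    ultimately show ?thesis
      using i by (cases "C i"; cases "D i") (simp add: slot_view_def slot_priv_def Z_def p_def comp_def priv_observe.simps)
  qed
  have EN: "E \<subseteq> {..<N} \<times> {..<N}" using fam by (simp add: X)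
  have dec: "decide M N (\<lambda>i. fst (Z i)) (slot_view M Z (\<lambda>j. input_at w (p j)) (look \<circ> T)) (slot_priv M Z (look \<circ> T)) E R E' \<longleftrightarrow>
      decide M N A (\<lambda>i. view w (C i)) (\<lambda>i. priv_observe (D i)) E R E'" for R E'
    by (rule decide_cong[OF views EN])
  have target: "((\<lambda>i. if i < N then (fst (R i), fst (fst (snd (R i))), fst (snd (snd (R i)))) else no_slot, E'),
      \<lambda>j. min (length w + 1) (shift (if j < N then fst (snd (fst (snd (R j)))) else Stay) (p j)),
      write_all (spread M N (0, Stay) (\<lambda>i. snd (snd (fst (snd (R i))))) (\<lambda>i. snd (snd (snd (R i))))) T) =
      family_config M N (\<lambda>i. fst (R i), \<lambda>i. update w (fst (snd (R i))) (C i), \<lambda>i. priv_update (snd (snd (R i))) (D i), E')"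
    if d: "decide M N A (\<lambda>i. view w (C i)) (\<lambda>i. priv_observe (D i)) E R E'" for R E'
  proof -
    have len: "length (snd (snd (fst (snd (R i))))) = pub_tapes M" "length (snd (snd (snd (R i)))) = priv_tapes M"
      if "i < N" for i
      using decide_inv[OF wf fam[unfolded X] d that] by blast+
    have "write_all (spread M N (0, Stay) (\<lambda>i. snd (snd (fst (snd (R i))))) (\<lambda>i. snd (snd (snd (R i))))) T =
        spread M N blank_tape (\<lambda>i. map2 write_move (snd (snd (fst (snd (R i))))) (snd (snd (C i))))
          (\<lambda>i. map2 write_move (snd (snd (snd (R i)))) (snd (D i)))"
      using len shape by (auto simp: fun_eq_iff write_all_def T_def spread_def write_blank
          simp del: write_move.simps split: sum.split)
    then show ?thesis
      by (auto simp: update_fields priv_update_fields p_def)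
  qed
  have "multihead_step (family_machine M N) w ((Z, E), p, T) Y \<longleftrightarrow> (\<exists>R E'.
      decide M N A (\<lambda>i. view w (C i)) (\<lambda>i. priv_observe (D i)) E R E' \<and>
      Y = ((\<lambda>i. if i < N then (fst (R i), fst (fst (snd (R i))), fst (snd (snd (R i)))) else no_slot, E'),
      \<lambda>j. min (length w + 1) (shift (if j < N then fst (snd (fst (snd (R j)))) else Stay) (p j)),
      write_all (spread M N (0, Stay) (\<lambda>i. snd (snd (fst (snd (R i))))) (\<lambda>i. snd (snd (snd (R i))))) T))"
    unfolding multihead_step_def family_machine_def dec[symmetric] by blast
  also have "\<dots> \<longleftrightarrow> (\<exists>R E'.
      decide M N A (\<lambda>i. view w (C i)) (\<lambda>i. priv_observe (D i)) E R E' \<and>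
      Y = family_config M N (\<lambda>i. fst (R i), \<lambda>i. update w (fst (snd (R i))) (C i), \<lambda>i. priv_update (snd (snd (R i))) (D i), E'))"
    using target by (metis (no_types, lifting))
  also have "\<dots> \<longleftrightarrow> (\<exists>X'. family_step M N w X X' \<and> Y = family_config M N X')"
    unfolding family_step_def X by blast
  finally show ?thesis unfolding pr .
qed

lemma family_config_reach:
  assumes wf: "patm_wf M" and fam: "family_inv M N w X"
  shows "(multihead_step (family_machine M N) w)\<^sup>*\<^sup>* (family_config M N X) Y \<longleftrightarrow> (\<exists>X'. (family_step M N w)\<^sup>*\<^sup>* X X' \<and> family_inv M N w X' \<and> Y = family_config M N X')"
proof
  assume "(multihead_step (family_machine M N) w)\<^sup>*\<^sup>* (family_config M N X) Y"
  then show "\<exists>X'. (family_step M N w)\<^sup>*\<^sup>* X X' \<and> family_inv M N w X' \<and> Y = family_config M N X'"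
  proof induction
    case base
    then show ?case using fam by blast
  next
    case (step Y Y')
    then obtain X' where 1: "(family_step M N w)\<^sup>*\<^sup>* X X'" "family_inv M N w X'" "Y = family_config M N X'" by blast
    then obtain X'' where 2: "family_step M N w X' X''" "Y' = family_config M N X''"
      using step(2) family_config_step[OF wf 1(2)] by blast
    show ?case
      using rtranclp.rtrancl_into_rtrancl[OF 1(1) 2(1)] family_step_inv[OF wf 1(2) 2(1)] 2(2) by blast
  qed
next
  assume "\<exists>X'. (family_step M N w)\<^sup>*\<^sup>* X X' \<and> family_inv M N w X' \<and> Y = family_config M N X'"
  then obtain X' where "(family_step M N w)\<^sup>*\<^sup>* X X'" and Y: "Y = family_config M N X'" by blast
  from this(1) have "(multihead_step (family_machine M N) w)\<^sup>*\<^sup>* (family_config M N X) (family_config M N X') \<and> family_inv M N w X'"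
  proof induction
    case base
    then show ?case using fam by blast
  next
    case (step X1 X2)
    then have "multihead_step (family_machine M N) w (family_config M N X1) (family_config M N X2)"
      using family_config_step[OF wf, of N w X1] by blast
    then show ?case using step family_step_inv[OF wf, of N w X1 X2]
      by (meson rtranclp.rtrancl_into_rtrancl)
  qed
  then show "(multihead_step (family_machine M N) w)\<^sup>*\<^sup>* (family_config M N X) Y" using Y by blast
qed

section \<open>The initial family, and the language as a set of accepting runs\<close>

definition init_family :: "'a patm \<Rightarrow> 'a rule list list \<Rightarrow> 'a family" where
  "init_family M us = (\<lambda>i. (start_mode M, us ! i, []),
     \<lambda>_. (start_pub M, 0, replicate (pub_tapes M) blank_tape),
     \<lambda>_. (start_priv M, replicate (priv_tapes M) blank_tape), {..<length us} \<times> {..<length us})"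

lemma init_family_inv:
  assumes "\<forall>u\<in>set us. set u \<subseteq> un_rules M"
  shows "family_inv M (length us) w (init_family M us)"
proof -
  have "patm_reach M w 0 (start_mode M, (start_pub M, 0, replicate (pub_tapes M) blank_tape),
      (start_priv M, replicate (priv_tapes M) blank_tape))"
    using reach_init[of M w] by (simp add: init_config_def)
  then show ?thesis using assms by (auto simp: init_family_def intro!: exI)
qed

text \<open>One and the same strategy wins the game and all dictated plays; the lists up to length
  \<open>K\<close> suffice by \<open>won_imp_wins\<close>.\<close>

lemma language_iff_run:
  assumes wf: "patm_wf M" and K: "\<And>w k x. patm_reach M w k x \<Longrightarrow> k \<le> K"
    and us: "set us = {u. set u \<subseteq> un_rules M \<and> length u \<le> K}"
  shows "w \<in> patm_language M \<longleftrightarrow>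
    (\<exists>Y. (family_step M (length us) w)\<^sup>*\<^sup>* (init_family M us) Y \<and> all_accept (length us) Y)"
proof -
  let ?N = "length us"
  let ?c = "(start_pub M, 0, replicate (pub_tapes M) blank_tape) :: mem"
  let ?d = "(start_priv M, replicate (priv_tapes M) blank_tape) :: priv_mem"
  have fam: "family_inv M ?N w (init_family M us)"
    using us by (intro init_family_inv) auto
  have hist: "hist_inv (pub_tapes M) ?N w (\<lambda>i. (start_mode M, us ! i, [])) (\<lambda>_. ?c) ({..<?N} \<times> {..<?N})
      (\<lambda>_. []) (\<lambda>_. ?c) 0"
    by (auto simp: hist_inv_def mem_ok_def)
  have "(\<exists>\<sigma>. wins M w \<sigma> [] (init_config M)) \<longleftrightarrow>
      (\<exists>\<sigma>. \<forall>i<?N. \<exists>n. won M w \<sigma> n (us ! i) [] (start_mode M) ?c ?d)"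
  proof (intro arg_cong[of _ _ Ex] ext iffI allI impI)
    fix \<sigma> i assume "wins M w \<sigma> [] (init_config M)" "i < ?N"
    then show "\<exists>n. won M w \<sigma> n (us ! i) [] (start_mode M) ?c ?d"
      using wins_imp_won[of M w \<sigma> "[]" "init_config M" "us ! i"] us nth_mem[of i us]
      by (auto simp: init_config_def)
  next
    fix \<sigma> assume a: "\<forall>i<?N. \<exists>n. won M w \<sigma> n (us ! i) [] (start_mode M) ?c ?d"
    have "\<exists>n. won M w \<sigma> n u [] (start_mode M) ?c ?d" if "set u \<subseteq> un_rules M" "length u \<le> K" for u
    proof -
      have "u \<in> set us" using that us by simp
      then show ?thesis using a by (metis in_set_conv_nth)
    qed
    then show "wins M w \<sigma> [] (init_config M)"
      using won_imp_wins[of M w K K \<sigma> "[]" "start_mode M" ?c ?d 0] K reach_init[of M w]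
      by (auto simp: init_config_def)
  qed
  also have "\<dots> \<longleftrightarrow> (\<exists>Y. (family_step M ?N w)\<^sup>*\<^sup>* (init_family M us) Y \<and> all_accept ?N Y)"
  proof
    assume "\<exists>\<sigma>. \<forall>i<?N. \<exists>n. won M w \<sigma> n (us ! i) [] (start_mode M) ?c ?d"
    then obtain \<sigma> f where f: "\<And>i. i < ?N \<Longrightarrow> won M w \<sigma> (f i) (us ! i) [] (start_mode M) ?c ?d"
      by metis
    show "\<exists>Y. (family_step M ?N w)\<^sup>*\<^sup>* (init_family M us) Y \<and> all_accept ?N Y"
      unfolding init_family_def
      by (rule won_imp_run[OF wf fam[unfolded init_family_def] hist, of \<sigma> f]) (simp add: f)
  next
    assume "\<exists>Y. (family_step M ?N w)\<^sup>*\<^sup>* (init_family M us) Y \<and> all_accept ?N Y"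
    then obtain Y where "(family_step M ?N w)\<^sup>*\<^sup>* (init_family M us) Y" "all_accept ?N Y" by blast
    from run_imp_won[OF wf this init_family_def fam hist]
    show "\<exists>\<sigma>. \<forall>i<?N. \<exists>n. won M w \<sigma> n (us ! i) [] (start_mode M) ?c ?d" by simp
  qed
  finally show ?thesis by (simp add: patm_language_def)
qed

text \<open>Correctness being settled, what remains is that the states, symbols and logs that occur
  form finite sets independent of the input.\<close>

lemma patm_language_in_NSPACE:
  fixes M :: "'a::finite patm"
  assumes wf: "patm_wf M" and sp: "patm_space M s" and "const_universal_moves M"
  shows "patm_language M \<in> NSPACE (\<lambda>n. s n + log_cells n)"
proof -
  obtain K where K: "\<And>w k x. patm_reach M w k x \<Longrightarrow> k \<le> K"
    using assms(3) unfolding const_universal_moves_def by blast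
  have finr: "finite (ex_rules M)" "finite (un_rules M)"
    using wf by (auto simp: patm_wf_def)
  obtain us where us: "set us = {u. set u \<subseteq> un_rules M \<and> length u \<le> K}"
    using finite_list[OF finite_lists_length_le[OF finr(2)]] by blast
  define N where "N = length us"
  \<comment> \<open>The empty list is among the slots, so there is at least one head, as the head
    simulation requires.\<close>
  have "[] \<in> set us" by (simp add: us)
  then have N: "0 < N" by (cases us) (auto simp: N_def)
  define AS where "AS = (\<lambda>(_, _, a). a) ` ex_rules M \<union> (\<lambda>(_, _, a, _). a) ` un_rules M"
  define BS where "BS = (\<lambda>(_, _, _, b). b) ` un_rules M"
  define QP where "QP = insert (start_pub M) (fst ` AS)"
  define QR where "QR = insert (start_priv M) (fst ` BS)"
  define syms where "syms = (\<Union>a\<in>AS. fst ` set (snd (snd a))) \<union> (\<Union>b\<in>BS. fst ` set (snd b))"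
  have fin: "finite AS" "finite BS" "finite QP" "finite QR" "finite syms"
    using finr by (auto simp: AS_def BS_def QP_def QR_def syms_def)
  obtain b0 where b0: "\<forall>x\<in>syms. x \<le> b0"
    using fin(5) by (auto simp: finite_nat_set_iff_bounded_le)
  \<comment> \<open>One bound for the symbols in the rules of \<open>M\<close> and the counter
    symbols up to 3.\<close>
  define b where "b = b0 + 3"
  have b: "\<And>x. x \<in> syms \<Longrightarrow> x \<le> b" "3 \<le> b" using b0 by (auto simp: b_def trans_le_add1)
  have bA: "fst e \<le> b" if "a \<in> AS" "e \<in> set (snd (snd a))" for a e
    using that by (intro b(1)) (auto simp: syms_def)
  have bB: "fst e \<le> b" if "b' \<in> BS" "e \<in> set (snd b')" for b' e
    using that by (intro b(1)) (auto simp: syms_def)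
  define VS :: "'a view set" where
    "VS = QP \<times> UNIV \<times> {ls. set ls \<subseteq> UNIV \<times> {..b} \<and> length ls = pub_tapes M}"
  have "finite VS"
    unfolding VS_def by (intro finite_cartesian_product fin finite_lists_length_eq) simp_all
  \<comment> \<open>A universal move takes a rule from the list and adds one entry to the log, while
    existential moves empty the log; so the two lengths together never exceed \<open>K\<close>, and
    logs stay bounded.\<close>
  define SL :: "('a aux \<times> nat \<times> nat) set" where "SL = (UNIV \<times> {u. set u \<subseteq> un_rules M \<and> length u \<le> K} \<times>
      {lg. set lg \<subseteq> VS \<times> AS \<and> length lg \<le> K}) \<times> QP \<times> QR \<inter>
      {((md, u, lg), q, r). length u + length lg \<le> K}"
  have "finite SL"
    unfolding SL_def
    by (intro finite_Int disjI1 finite_cartesian_product fin finite_lists_length_le finr \<open>finite VS\<close>) simp_all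
  define Q :: "'a family_state set" where
    "Q = {Z. (\<forall>i<N. Z i \<in> SL) \<and> (\<forall>i\<ge>N. Z i = no_slot)} \<times> Pow ({..<N} \<times> {..<N})"
  have finQ: "finite Q"
    unfolding Q_def by (intro finite_cartesian_product finite_funs_on \<open>finite SL\<close>) simp
  define I where "I = {..<N} \<times> ({..<pub_tapes M} <+> {..<priv_tapes M})"
  define z0 where "z0 = fst (family_config M N (init_family M us))"
  have init: "family_config M N (init_family M us) = (z0, \<lambda>_. 0, \<lambda>_. blank_tape)"
    by (auto simp: z0_def init_family_def spread_def fun_eq_iff split: sum.split)
  have fam: "family_inv M N w (init_family M us)" for w
    using us unfolding N_def by (intro init_family_inv) auto
  have reach: "(multihead_step (family_machine M N) w)\<^sup>*\<^sup>* (z0, \<lambda>_. 0, \<lambda>_. blank_tape) Y \<longleftrightarrow>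
      (\<exists>X. (family_step M N w)\<^sup>*\<^sup>* (init_family M us) X \<and> family_inv M N w X \<and> Y = family_config M N X)" for w Y
    using family_config_reach[OF wf fam] unfolding init .
  define acc :: "'a family_state \<Rightarrow> bool" where "acc z = (\<forall>i<N. fst (fst (fst z i)) = Accept)" for z
  have acc: "acc (fst (family_config M N X)) \<longleftrightarrow> all_accept N X" for X
    by (cases X) (simp add: acc_def all_accept_def)
  have lang: "w \<in> patm_language M \<longleftrightarrow> (\<exists>Y. (family_step M N w)\<^sup>*\<^sup>* (init_family M us) Y \<and> all_accept N Y)" for w
    unfolding N_def by (rule language_iff_run[OF wf _ us]) (rule K)
  have "patm_language M = {w. \<exists>z p T. (multihead_step (family_machine M N) w)\<^sup>*\<^sup>* (z0, \<lambda>_. 0, \<lambda>_. blank_tape) (z, p, T) \<and> acc z}"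
  proof (intro set_eqI iffI)
    fix w assume "w \<in> patm_language M"
    then obtain X where X: "(family_step M N w)\<^sup>*\<^sup>* (init_family M us) X" "all_accept N X"
      using lang by blast
    have "family_inv M N w X"
      using X(1) by induction (use fam family_step_inv[OF wf] in blast)+
    then have "(multihead_step (family_machine M N) w)\<^sup>*\<^sup>* (z0, \<lambda>_. 0, \<lambda>_. blank_tape) (family_config M N X)"
      using reach X(1) by blast
    moreover obtain z p T where zpT: "family_config M N X = (z, p, T)" by (metis prod.exhaust)
    moreover have "acc z" using acc[of X] X(2) zpT by simp
    ultimately show "w \<in> {w. \<exists>z p T. (multihead_step (family_machine M N) w)\<^sup>*\<^sup>* (z0, \<lambda>_. 0, \<lambda>_. blank_tape) (z, p, T) \<and> acc z}"
      by (metis (mono_tags, lifting) mem_Collect_eq)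
  next
    fix w assume "w \<in> {w. \<exists>z p T. (multihead_step (family_machine M N) w)\<^sup>*\<^sup>* (z0, \<lambda>_. 0, \<lambda>_. blank_tape) (z, p, T) \<and> acc z}"
    then obtain z p T X where X: "(family_step M N w)\<^sup>*\<^sup>* (init_family M us) X" "(z, p, T) = family_config M N X" "acc z"
      using reach by blast
    then have "all_accept N X" using acc[of X] by (metis fst_conv)
    then show "w \<in> patm_language M"
      using lang X(1) by blast
  qed
  also have "\<dots> \<in> NSPACE (\<lambda>n. s n + log_cells n)"
  proof (rule multihead_in_NSPACE[OF finQ _ _ b(2) N])
    show "finite I" by (simp add: I_def)
    have "(start_mode M, us ! i, []) \<in> UNIV \<times> {u. set u \<subseteq> un_rules M \<and> length u \<le> K} \<times>
        {lg. set lg \<subseteq> VS \<times> AS \<and> length lg \<le> K}" if "i < N" for i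
      using us nth_mem[of i us] that by (auto simp: N_def)
    then show "z0 \<in> Q"
      by (auto simp: z0_def init_family_def Q_def SL_def QP_def QR_def N_def)
  next
    fix w z p T i
    assume "(multihead_step (family_machine M N) w)\<^sup>*\<^sup>* (z0, \<lambda>_. 0, \<lambda>_. blank_tape) (z, p, T)" and i: "i \<in> I"
    then obtain A C D E where "family_inv M N w (A, C, D, E)" and T: "(z, p, T) = family_config M N (A, C, D, E)"
      using reach by (metis prod.exhaust)
    then have inv: "slot_inv M w (A (fst i)) (C (fst i)) (D (fst i))"
      using i by (auto simp: I_def simp del: slot_inv.simps)
    then obtain k md where r: "patm_reach M w k (md, C (fst i), D (fst i))"
      by (cases "A (fst i)") auto
    obtain q h ts where c: "C (fst i) = (q, h, ts)" by (metis prod.exhaust)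
    obtain r us where d: "D (fst i) = (r, us)" by (metis prod.exhaust)
    have "tapes_within (s (length w)) ts" "tapes_within (s (length w)) us"
      using sp r unfolding c d patm_space_def by blast+
    moreover have "T i \<in> set ts \<union> set us"
      using T i c d slot_inv_shape[OF wf inv] by (auto simp: I_def spread_def mem_ok_def)
    ultimately show "fst (T i) < s (length w)" by (auto simp: tapes_within_def)
  next
    fix z xs ob z' m a
    assume z: "z \<in> Q" and ob: "ob \<in> obs_on I {..b}" and st: "family_machine M N z xs ob (z', m, a)"
    obtain Z E R E' where ZE: "z = (Z, E)"
      and dec: "decide M N (\<lambda>i. fst (Z i)) (slot_view M Z xs ob) (slot_priv M Z ob) E R E'"
      and z': "z' = (\<lambda>i. if i < N then (fst (R i), fst (fst (snd (R i))), fst (snd (snd (R i)))) else no_slot, E')"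
      and m: "m = (\<lambda>i. if i < N then fst (snd (fst (snd (R i)))) else Stay)"
      and a: "a = spread M N (0, Stay) (\<lambda>i. snd (snd (fst (snd (R i))))) (\<lambda>i. snd (snd (snd (R i))))"
      using st unfolding family_machine_def by blast
    have E': "E' \<subseteq> {..<N} \<times> {..<N}"
      using dec z by (auto simp: decide_def indist_def ZE Q_def)
    define okA where "okA a \<longleftrightarrow> fst a \<in> QP \<and> length (snd (snd a)) = pub_tapes M \<and>
      (\<forall>e\<in>set (snd (snd a)). fst e \<le> b)" for a :: action
    define okB where "okB b' \<longleftrightarrow> fst b' \<in> QR \<and> length (snd b') = priv_tapes M \<and>
      (\<forall>e\<in>set (snd b'). fst e \<le> b)" for b' :: priv_action
    have ex_ok: "okA a \<and> a \<in> AS" if "(t, md, a) \<in> ex_rules M" for t md a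
    proof -
      have "a \<in> AS" using that by (force simp: AS_def)
      then show ?thesis
        using ex_rule_length[OF wf that] bA by (simp add: okA_def QP_def)
    qed
    have un_ok: "okA a \<and> a \<in> AS \<and> okB b'" if "(t, md, a, b') \<in> un_rules M" for t md a b'
    proof -
      have "a \<in> AS" "b' \<in> BS" using that by (force simp: AS_def BS_def)+
      then show ?thesis
        using un_rule_length[OF wf that] bA bB by (simp add: okA_def okB_def QP_def QR_def)
    qed
    have slot: "(fst (R i), fst (fst (snd (R i))), fst (snd (snd (R i)))) \<in> SL \<and>
        okA (fst (snd (R i))) \<and> okB (snd (snd (R i)))" if i: "i < N" for i
    proof -
      obtain md u lg q r where Zi: "Z i = ((md, u, lg), q, r)" by (metis prod.exhaust)
      have SLi: "((md, u, lg), q, r) \<in> SL" using z i Zi unfolding ZE Q_def by auto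
      obtain x' a b' where Ri: "R i = (x', a, b')" by (metis prod.exhaust)
      define v where "v = slot_view M Z xs ob i"
      define pt where "pt = slot_priv M Z ob i"
      have "ob (i, t) \<in> UNIV \<times> {..b}" if "t \<in> {..<pub_tapes M} <+> {..<priv_tapes M}" for t
        using ob i that unfolding obs_on_def I_def by blast
      then have obs: "\<And>j. j < pub_tapes M \<Longrightarrow> snd (ob (i, Inl j)) \<le> b"
        and obs': "\<And>j. j < priv_tapes M \<Longrightarrow> snd (ob (i, Inr j)) \<le> b"
        by (auto simp: mem_Times_iff)
      have "set (map (\<lambda>j. ob (i, Inl j)) [0..<pub_tapes M]) \<subseteq> UNIV \<times> {..b}"
        using obs by (auto simp only: set_map image_subset_iff mem_Times_iff atLeastLessThan_iff set_upt UNIV_I atMost_iff)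
      then have v: "v \<in> VS" using SLi by (simp add: v_def slot_view_def VS_def Zi SL_def)
      have idA: "okA (idle_action (view_trigger v))"
        using v by (cases v) (auto simp: okA_def VS_def)
      have idB: "okB (idle_priv pt)"
        using SLi obs' by (auto simp: okB_def pt_def slot_priv_def Zi SL_def)
      consider (univ) "R i = univ_decision (md, u, lg) v pt"
        | (exist) \<mu> where "md = Exist \<Longrightarrow> (view_trigger v, \<mu>) \<in> ex_rules M" "R i = exist_decision \<mu> (md, u, lg) v pt"
        using dec i unfolding decide_def v_def pt_def
        by (elim disjE conjE exE) (metis Zi fst_conv)+
      then show ?thesis
      proof cases
        case univ
        consider (idle) "x' = (md, u, lg) \<or> x' = (Accept, u, lg)" "a = idle_action (view_trigger v)" "b' = idle_priv pt"
          | (move) t md' u' where "u = (t, (md', a, b')) # u'" "x' = (md', u', lg @ [(v, a)])"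
          using univ Ri by (auto split: mode.splits list.splits prod.splits if_splits)
        then show ?thesis
        proof cases
          case idle
          then show ?thesis using SLi idA idB Ri by (auto simp: SL_def okA_def okB_def)
        next
          case move
          then have "(t, md', a, b') \<in> un_rules M" using SLi by (auto simp: SL_def)
          from un_ok[OF this] show ?thesis using SLi move Ri v by (auto simp: SL_def okA_def okB_def)
        qed
      next
        case exist
        obtain md' a' where mu: "\<mu> = (md', a')" by (rule prod.exhaust)
        show ?thesis
        proof (cases "md = Exist")
          case True
          then have "(view_trigger v, md', a') \<in> ex_rules M" using exist(1) mu by simp
          from ex_ok[OF this] show ?thesis
            using SLi exist(2) mu True Ri idB by (auto simp: SL_def okA_def okB_def)
        next
          case False
          then show ?thesis using SLi exist(2) mu Ri idA idB by (auto simp: SL_def okA_def okB_def)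
        qed
      qed
    qed
    have "a x \<in> {..b} \<times> UNIV" if "x \<in> I" for x
    proof -
      obtain i t where x: "x = (i, t)" by (rule prod.exhaust)
      then have "i < N" using that by (simp add: I_def)
      from slot[OF this] show ?thesis
        using that unfolding a x I_def okA_def okB_def
        by (cases t) (auto simp: spread_def mem_Times_iff)
    qed
    moreover have "a x = (0, Stay)" if "x \<notin> I" for x
      using that unfolding a I_def by (cases x; cases "snd x") (auto simp: spread_def)
    ultimately have "a \<in> acts_on I {..b}" unfolding acts_on_def by blast
    moreover have "z' \<in> Q" using slot E' unfolding z' Q_def by simp
    ultimately show "z' \<in> Q \<and> a \<in> acts_on I {..b} \<and> (\<forall>j\<ge>N. m j = Stay)"
      by (simp add: m)
  qed
  finally show ?thesis .
qed

section \<open>Logarithmic bounds and the upper inclusions\<close>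

lemma log_bounds_log_cells:
  assumes "s \<in> log_bounds"
  shows "(\<lambda>n. s n + log_cells n) \<in> log_bounds"
proof -
  have "norm (real (log_cells n)) \<le> 1 * norm (log 2 (real n + 2) + 1)" for n
  proof -
    have "0 \<le> log 2 (real n + 2)" by simp
    then show ?thesis
      using of_int_floor_le[of "log 2 (real n + 2)"] by (simp add: log_cells_def add.commute)
  qed
  then have "(\<lambda>n. real (log_cells n)) \<in> O(\<lambda>n. log 2 (real n + 2) + 1)"
    by (intro bigoI[of _ 1] always_eventually) blast
  also have "(\<lambda>n. log 2 (real n + 2) + 1) \<in> O(\<lambda>n. ln (real n))"
    by real_asymp
  finally show ?thesis
    using assms by (auto simp: log_bounds_def intro: sum_in_bigo)
qed

lemma PATM_subset_NL:
  assumes "s \<in> log_bounds"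
  shows "PATM_space_const_universal s \<subseteq> (NL :: 'a::finite list set set)"
  using patm_language_in_NSPACE log_bounds_log_cells[OF assms]
  by (auto simp: PATM_space_const_universal_def NL_def)

lemma BATM_subset_PATM: "BATM_space_const_universal s \<subseteq> PATM_space_const_universal s"
  by (auto simp: BATM_space_const_universal_def PATM_space_const_universal_def)

section \<open>Nondeterministic machines as blind alternating machines\<close>

text \<open>Acceptance is a mode that a rule enters, so it is read off the next control state; the
  start mode covers an accepting start state. Play stops at the first accepting state, which is
  harmless since reaching one suffices.\<close>

definition patm_of_ntm :: "'a ntm \<Rightarrow> 'a patm" where
  "patm_of_ntm M = (let md = (\<lambda>q. if q \<in> ntm_accepting M then Accept else Exist) in
     \<lparr>pub_tapes = ntm_tapes M, priv_tapes = 0, start_mode = md (ntm_start M),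
      start_pub = ntm_start M, start_priv = 0,
      ex_rules = (\<lambda>(t, a). (t, (md (fst a), a))) ` ntm_rules M, un_rules = {}\<rparr>)"

lemma patm_of_ntm_reach:
  assumes "patm_reach (patm_of_ntm M) w k x"
  shows "k = 0 \<and> snd (snd x) = (0, []) \<and> ntm_reach M w (fst (snd x))"
  using assms
proof induction
  case reach_init
  then show ?case using ntm_init by (auto simp: init_config_def patm_of_ntm_def Let_def)
next
  case (reach_exist k c d md a)
  then have "(observe w c, a) \<in> ntm_rules M" by (auto simp: patm_of_ntm_def Let_def)
  from ntm_step[OF _ this] show ?case using reach_exist.IH by simp
next
  case (reach_univ k c d md a b)
  then show ?case by (simp add: patm_of_ntm_def Let_def)
qed

text \<open>The strategy replays the accepting run. Since it sees the whole history, it can move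
  differently when a configuration recurs.\<close>

lemma patm_of_ntm_accepts:
  assumes "(\<lambda>x y. \<exists>a. (observe w x, a) \<in> ntm_rules M \<and> y = update w a x)\<^sup>*\<^sup>* c c'"
    and "fst c' \<in> ntm_accepting M"
  shows "\<exists>\<sigma>. wins (patm_of_ntm M) w \<sigma> hs (if fst c \<in> ntm_accepting M then Accept else Exist, c, d)"
  using assms
proof (induction arbitrary: hs rule: converse_rtranclp_induct)
  case base
  then show ?case by (auto intro: wins_accept)
next
  case (step c c1)
  then obtain a where a: "(observe w c, a) \<in> ntm_rules M" and c1: "c1 = update w a c" by blast
  define md where "md = (if fst c1 \<in> ntm_accepting M then Accept else Exist)"
  obtain \<sigma> where \<sigma>: "wins (patm_of_ntm M) w \<sigma> (hs @ [c]) (md, c1, d)"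
    using step.IH[OF step.prems, of "hs @ [c]"] unfolding md_def by blast
  have r: "(observe w c, (md, a)) \<in> ex_rules (patm_of_ntm M)"
    using a by (force simp: patm_of_ntm_def Let_def md_def c1 update_fields)
  \<comment> \<open>The rest of the play consults only longer histories, so overriding this value
    does not disturb it.\<close>
  define \<sigma>' where "\<sigma>' h = (if h = hs @ [c] then (md, a) else \<sigma> h)" for h
  have cong: "wins N w \<sigma> hs' x \<Longrightarrow> length hs < length hs' \<Longrightarrow> wins N w \<sigma>' hs' x" for N hs' x
  proof (induction rule: wins.induct)
    case (wins_exist hs' c' md' a' d')
    then have "\<sigma>' (hs' @ [c']) = (md', a')" by (auto simp: \<sigma>'_def)
    then show ?case using wins_exist wins.wins_exist[of \<sigma>' hs' c' md' a' w N d'] by simp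
  qed (auto intro: wins.intros)
  have "wins (patm_of_ntm M) w \<sigma>' (hs @ [c]) (md, update w a c, d)"
    using cong[OF \<sigma>] c1 by simp
  then have "wins (patm_of_ntm M) w \<sigma>' hs (Exist, c, d)"
    using wins_exist[of \<sigma>' hs c md a w "patm_of_ntm M" d] r by (simp add: \<sigma>'_def)
  then show ?case by (cases "fst c \<in> ntm_accepting M") (auto intro: wins_accept)
qed

lemma ntm_reach_iff_rtranclp:
  "ntm_reach M w c \<longleftrightarrow> (\<lambda>x y. \<exists>a. (observe w x, a) \<in> ntm_rules M \<and> y = update w a x)\<^sup>*\<^sup>*
     (ntm_start M, 0, replicate (ntm_tapes M) blank_tape) c"
proof
  assume "ntm_reach M w c"
  then show "(\<lambda>x y. \<exists>a. (observe w x, a) \<in> ntm_rules M \<and> y = update w a x)\<^sup>*\<^sup>*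
     (ntm_start M, 0, replicate (ntm_tapes M) blank_tape) c"
    by induction (auto intro: rtranclp.rtrancl_into_rtrancl)
next
  assume "(\<lambda>x y. \<exists>a. (observe w x, a) \<in> ntm_rules M \<and> y = update w a x)\<^sup>*\<^sup>*
     (ntm_start M, 0, replicate (ntm_tapes M) blank_tape) c"
  then show "ntm_reach M w c"
    by induction (auto intro: ntm_init ntm_step)
qed

text \<open>The play that follows the strategy is itself a run of \<open>M\<close>, and it can be
  won only in mode \<open>Accept\<close>, as there are no universal turns.\<close>

lemma patm_of_ntm_sound:
  assumes "wins (patm_of_ntm M) w \<sigma> hs x" and "ntm_reach M w (fst (snd x))"
    and "fst x = (if fst (fst (snd x)) \<in> ntm_accepting M then Accept else Exist)"
  shows "w \<in> ntm_language M"
  using assms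
proof (induction rule: wins.induct)
  case (wins_accept hs c d)
  then show ?case by (cases c) (auto simp: ntm_language_def split: if_splits)
next
  case (wins_exist hs c md a d)
  then have r: "(observe w c, a) \<in> ntm_rules M" and md: "md = (if fst a \<in> ntm_accepting M then Accept else Exist)"
    by (auto simp: patm_of_ntm_def Let_def)
  show ?case
    by (rule wins_exist.IH) (use ntm_step[OF _ r] wins_exist.prems md in \<open>auto simp: update_fields\<close>)
next
  case (wins_univ c d hs)
  then show ?case by (simp split: if_splits)
qed

lemma patm_of_ntm_language: "patm_language (patm_of_ntm M) = ntm_language M"
proof (intro set_eqI iffI)
  fix w assume "w \<in> patm_language (patm_of_ntm M)"
  then obtain \<sigma> where "wins (patm_of_ntm M) w \<sigma> [] (init_config (patm_of_ntm M))"
    by (auto simp: patm_language_def)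
  then show "w \<in> ntm_language M"
    by (rule patm_of_ntm_sound) (auto simp: init_config_def patm_of_ntm_def Let_def intro: ntm_init)
next
  fix w assume "w \<in> ntm_language M"
  then obtain c where "ntm_reach M w c" "fst c \<in> ntm_accepting M" by (auto simp: ntm_language_def)
  from patm_of_ntm_accepts[OF this(1)[unfolded ntm_reach_iff_rtranclp] this(2), of "[]" "(0, [])"]
  show "w \<in> patm_language (patm_of_ntm M)"
    by (simp add: patm_language_def init_config_def patm_of_ntm_def Let_def)
qed

lemma NSPACE_subset_BATM: "NSPACE s \<subseteq> BATM_space_const_universal s"
proof
  fix L assume "L \<in> NSPACE s"
  then obtain M where L: "L = ntm_language M" and M: "ntm_wf M" "ntm_space M s"
    by (auto simp: NSPACE_def)
  have "patm_wf (patm_of_ntm M)"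
    using M(1) by (fastforce simp: patm_wf_def ntm_wf_def patm_of_ntm_def Let_def)
  moreover have "blind (patm_of_ntm M)" by (simp add: blind_def patm_of_ntm_def Let_def)
  moreover have "patm_space (patm_of_ntm M) s"
    using M(2) patm_of_ntm_reach by (fastforce simp: patm_space_def ntm_space_def tapes_within_def)
  moreover have "const_universal_moves (patm_of_ntm M)"
    unfolding const_universal_moves_def using patm_of_ntm_reach by blast
  ultimately show "L \<in> BATM_space_const_universal s"
    unfolding L patm_of_ntm_language[symmetric] BATM_space_const_universal_def by blast
qed

theorem theorem9:
  shows "(\<Union>s\<in>log_bounds. PATM_space_const_universal s) = (NL :: 'a::finite list set set) \<and>
         (\<Union>s\<in>log_bounds. BATM_space_const_universal s) = (NL :: 'a::finite list set set)"
proof -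
  have "NL \<subseteq> (\<Union>s\<in>log_bounds. BATM_space_const_universal s :: 'a list set set)"
    using NSPACE_subset_BATM unfolding NL_def by blast
  moreover have "(\<Union>s\<in>log_bounds. BATM_space_const_universal s) \<subseteq>
      (\<Union>s\<in>log_bounds. PATM_space_const_universal s :: 'a list set set)"
    using BATM_subset_PATM by blast
  moreover have "(\<Union>s\<in>log_bounds. PATM_space_const_universal s) \<subseteq> (NL :: 'a list set set)"
    using PATM_subset_NL by blast
  ultimately show ?thesis by blast
qed

end
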